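(* Let $n\ge 1$. The ring of invariants $(P_n\otimes E_n)^{GL_n(\mathbb{F}_q)}$ of the polynomial tensor exterior algebra $P_n\otimes E_n$ with respect to the action of the general linear group $GL_n(\mathbb{F}_q)$ is a free $P_n^{GL_n(\mathbb{F}_q)}$-module with the basis $\{1\}\cup\{e_n^{q-2}\,Q_I\,dx_1\cdots dx_n : I\in A'_n\}$.
   Context: Let $p$ be an odd prime, $q$ a power of $p$, $\mathbb{F}_q$ the field with $q$ elements. $P_n=\mathbb{F}_q[x_1,\dots,x_n]$; $E_n=\Lambda(dx_1,\dots,dx_n)$ is the exterior algebra over $\mathbb{F}_q$ on $dx_1,\dots,dx_n$, with $E_n^r=\Lambda^r(dx_1,\dots,dx_n)$. $P_n\otimes E_n$ (tensor over $\mathbb{F}_q$) is graded by $\deg x_i=2$, $\deg dx_i=1$. Action: for $g\in GL_n(\mathbb{F}_q)$, $g x_i=\sum_{j} a_{i,j}(g^{-1})x_j$, $g\,dx_i=\sum_j a_{i,j}(g^{-1})dx_j$, $g(xy)=g(x)g(y)$, where $a_{i,j}(g^{-1})$ is the $(i,j)$ entry of $g^{-1}$. Milnor operations: for $j\ge 0$, $Q_j:P_n\otimes E_n^r\to P_n\otimes E_n^{r-1}$ is the $P_n$-linear derivation determined by $Q_j(xy)=(Q_jx)y+(-1)^{\deg x}x(Q_jy)$, $Q_j\,dx_i=x_i^{q^j}$, $Q_jx_i=0$. For $I=\{i_1<\dots<i_r\}$, $Q_I=Q_{i_1}\cdots Q_{i_r}$, and $Q_\emptyset=1$. $A'_n$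 denotes the set of proper subsets of $\{0,1,\dots,n-1\}$ (including $\emptyset$). Finally $e_n=e_n(x_1,\dots,x_n)=Q_0Q_1\cdots Q_{n-1}dx_1\cdots dx_n\in P_n$. *)

theory Defs
  imports "HOL-Analysis.Analysis" "HOL-Library.Poly_Mapping"
begin

section \<open>Exterior algebras over a commutative ring\<close>

text \<open>
  The exterior algebra over \<open>'r\<close> on generators \<open>dx i\<close>, where \<open>i\<close> ranges over the finite linearly
  ordered type \<open>'n\<close>.  An element is the family of its coordinates with respect to the
  monomials \<open>dx i\<^sub>1 * \<dots> * dx i\<^sub>r\<close> with \<open>i\<^sub>1 < \<dots> < i\<^sub>r\<close>, indexed by the sets \<open>{i\<^sub>1, \<dots>, i\<^sub>r}\<close>.
\<close>

typedef ('r, 'n) exterior = "UNIV :: ('n set \<Rightarrow> 'r) set"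
  morphisms ext_coeff Abs_exterior ..

setup_lifting type_definition_exterior

lemma exterior_eqI: "(\<And>S. ext_coeff u S = ext_coeff v S) \<Longrightarrow> u = v"
  by (metis ext ext_coeff_inject)

text \<open>The sign of the shuffle that sorts \<open>S\<close> followed by \<open>T\<close>, for disjoint \<open>S\<close> and \<open>T\<close>.\<close>

definition shuffle_sign :: "'n::{finite,linorder} set \<Rightarrow> 'n set \<Rightarrow> 'r::comm_ring_1" where
  "shuffle_sign S T = (- 1) ^ card {(s, t). s \<in> S \<and> t \<in> T \<and> t < s}"

lemma shuffle_sign_empty [simp]: "shuffle_sign {} T = 1" "shuffle_sign S {} = 1"
  by (simp_all add: shuffle_sign_def)

lemma shuffle_sign_Un_left:
  assumes "S \<inter> S' = {}"
  shows "shuffle_sign (S \<union> S') T = shuffle_sign S T * shuffle_sign S' T"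
proof -
  have "{(s, t). s \<in> S \<union> S' \<and> t \<in> T \<and> t < s} =
    {(s, t). s \<in> S \<and> t \<in> T \<and> t < s} \<union> {(s, t). s \<in> S' \<and> t \<in> T \<and> t < s}" by auto
  moreover have "{(s, t). s \<in> S \<and> t \<in> T \<and> t < s} \<inter> {(s, t). s \<in> S' \<and> t \<in> T \<and> t < s} = {}"
    using assms by auto
  ultimately show ?thesis
    by (simp add: shuffle_sign_def card_Un_disjoint power_add)
qed

lemma shuffle_sign_Un_right:
  assumes "T \<inter> T' = {}"
  shows "shuffle_sign S (T \<union> T') = shuffle_sign S T * shuffle_sign S T'"
proof -
  have "{(s, t). s \<in> S \<and> t \<in> T \<union> T' \<and> t < s} =
    {(s, t). s \<in> S \<and> t \<in> T \<and> t < s} \<union> {(s, t). s \<in> S \<and> t \<in> T' \<and> t < s}" by auto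
  moreover have "{(s, t). s \<in> S \<and> t \<in> T \<and> t < s} \<inter> {(s, t). s \<in> S \<and> t \<in> T' \<and> t < s} = {}"
    using assms by auto
  ultimately show ?thesis
    by (simp add: shuffle_sign_def card_Un_disjoint power_add)
qed

lemma shuffle_sign_singleton: "shuffle_sign {i} T = (- 1) ^ card {t \<in> T. t < i}"
proof -
  have "{(s, t). s \<in> {i} \<and> t \<in> T \<and> t < s} = Pair i ` {t \<in> T. t < i}" by auto
  moreover have "card (Pair i ` {t \<in> T. t < i}) = card {t \<in> T. t < i}"
    by (rule card_image) (simp add: inj_on_def)
  ultimately show ?thesis by (simp only: shuffle_sign_def)
qed

instantiation exterior :: (comm_ring_1, "{finite,linorder}") ring_1
begin

lift_definition zero_exterior :: "('a, 'b) exterior" is "\<lambda>_. 0" .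
lift_definition one_exterior :: "('a, 'b) exterior" is "\<lambda>S. if S = {} then 1 else 0" .
lift_definition plus_exterior :: "('a, 'b) exterior \<Rightarrow> ('a, 'b) exterior \<Rightarrow> ('a, 'b) exterior"
  is "\<lambda>u v S. u S + v S" .
lift_definition minus_exterior :: "('a, 'b) exterior \<Rightarrow> ('a, 'b) exterior \<Rightarrow> ('a, 'b) exterior"
  is "\<lambda>u v S. u S - v S" .
lift_definition uminus_exterior :: "('a, 'b) exterior \<Rightarrow> ('a, 'b) exterior"
  is "\<lambda>u S. - u S" .
lift_definition times_exterior :: "('a, 'b) exterior \<Rightarrow> ('a, 'b) exterior \<Rightarrow> ('a, 'b) exterior"
  is "\<lambda>u v S. \<Sum>T\<in>Pow S. shuffle_sign T (S - T) * u T * v (S - T)" .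

instance
proof
  fix a b c :: "('a, 'b) exterior"
  show "a * b * c = a * (b * c)"
  proof (rule exterior_eqI)
    fix S :: "'b set"
    let ?s = "shuffle_sign :: 'b set \<Rightarrow> 'b set \<Rightarrow> 'a"
    let ?u = "ext_coeff a" and ?v = "ext_coeff b" and ?w = "ext_coeff c"
    have "ext_coeff (a * b * c) S =
      (\<Sum>W\<in>Pow S. \<Sum>T\<in>Pow W. ?s W (S - W) * (?s T (W - T) * ?u T * ?v (W - T)) * ?w (S - W))"
      by (simp add: times_exterior.rep_eq sum_distrib_left sum_distrib_right)
    also have "\<dots> = (\<Sum>(W, T)\<in>Sigma (Pow S) Pow.
        ?s W (S - W) * (?s T (W - T) * ?u T * ?v (W - T)) * ?w (S - W))"
      by (subst sum.Sigma) auto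
    also have "\<dots> = (\<Sum>(T, V)\<in>Sigma (Pow S) (\<lambda>T. Pow (S - T)).
        ?s T (S - T) * ?u T * (?s V (S - T - V) * ?v V * ?w (S - T - V)))"
    proof (rule sum.reindex_bij_witness
        [where i = "\<lambda>(T, V). (T \<union> V, T)" and j = "\<lambda>(W, T). (T, W - T)"])
      fix x assume "x \<in> Sigma (Pow S) Pow"
      then obtain W T where x: "x = (W, T)" and sub: "W \<subseteq> S" "T \<subseteq> W" by auto
      have W: "W = T \<union> (W - T)" and ST: "S - T = (W - T) \<union> (S - W)" using sub by auto
      have "?s W (S - W) = ?s T (S - W) * ?s (W - T) (S - W)"
        by (subst W, subst shuffle_sign_Un_left) auto
      moreover have "?s T (S - T) = ?s T (W - T) * ?s T (S - W)"
        by (subst ST, subst shuffle_sign_Un_right) (use sub in auto)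
      moreover have "S - T - (W - T) = S - W" using sub by auto
      ultimately show "(case case x of (W, T) \<Rightarrow> (T, W - T) of (T, V) \<Rightarrow>
          ?s T (S - T) * ?u T * (?s V (S - T - V) * ?v V * ?w (S - T - V))) =
        (case x of (W, T) \<Rightarrow> ?s W (S - W) * (?s T (W - T) * ?u T * ?v (W - T)) * ?w (S - W))"
        by (simp add: x)
    qed auto
    also have "\<dots> = (\<Sum>T\<in>Pow S. \<Sum>V\<in>Pow (S - T).
        ?s T (S - T) * ?u T * (?s V (S - T - V) * ?v V * ?w (S - T - V)))"
      by (subst sum.Sigma) auto
    also have "\<dots> = ext_coeff (a * (b * c)) S"
      by (simp add: times_exterior.rep_eq sum_distrib_left)
    finally show "ext_coeff (a * b * c) S = ext_coeff (a * (b * c)) S" .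
  qed
next
  fix a :: "('a, 'b) exterior"
  show "1 * a = a"
  proof (rule exterior_eqI)
    fix S :: "'b set"
    have "ext_coeff (1 * a) S =
      (\<Sum>T\<in>Pow S. if T = {} then shuffle_sign T (S - T) * ext_coeff a (S - T) else 0)"
      unfolding times_exterior.rep_eq one_exterior.rep_eq by (intro sum.cong) auto
    also have "\<dots> = ext_coeff a S" by (subst sum.delta) auto
    finally show "ext_coeff (1 * a) S = ext_coeff a S" .
  qed
  show "a * 1 = a"
  proof (rule exterior_eqI)
    fix S :: "'b set"
    have "ext_coeff (a * 1) S =
      (\<Sum>T\<in>Pow S. if T = S then shuffle_sign T (S - T) * ext_coeff a T else 0)"
      unfolding times_exterior.rep_eq one_exterior.rep_eq by (intro sum.cong) auto
    also have "\<dots> = ext_coeff a S" by (subst sum.delta) auto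
    finally show "ext_coeff (a * 1) S = ext_coeff a S" .
  qed
next
  show "(0::('a, 'b) exterior) \<noteq> 1"
  proof
    assume "(0::('a, 'b) exterior) = 1"
    then have "ext_coeff (0::('a, 'b) exterior) {} = ext_coeff 1 {}" by simp
    then show False by (simp add: zero_exterior.rep_eq one_exterior.rep_eq)
  qed
next
  fix a b c :: "('a, 'b) exterior"
  show "(a + b) * c = a * c + b * c"
    by (rule exterior_eqI)
      (simp add: times_exterior.rep_eq plus_exterior.rep_eq algebra_simps sum.distrib)
  show "a * (b + c) = a * b + a * c"
    by (rule exterior_eqI)
      (simp add: times_exterior.rep_eq plus_exterior.rep_eq algebra_simps sum.distrib)
qed (transfer; simp add: algebra_simps fun_eq_iff)+

end

lift_definition ext_scale :: "'r::comm_ring_1 \<Rightarrow> ('r, 'n::{finite,linorder}) exterior \<Rightarrow> ('r, 'n) exterior"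
  (infixr \<open>*\<^sub>E\<close> 75) is "\<lambda>r u S. r * u S" .

lift_definition dx :: "'n::{finite,linorder} \<Rightarrow> ('r::comm_ring_1, 'n) exterior"
  is "\<lambda>i S. if S = {i} then 1 else 0" .

text \<open>The product of \<open>\<eta> i\<close> for \<open>i \<in> S\<close>, taken in increasing order of \<open>i\<close>.\<close>

definition ordered_prod :: "('n::{finite,linorder} \<Rightarrow> 'm::monoid_mult) \<Rightarrow> 'n set \<Rightarrow> 'm" where
  "ordered_prod \<eta> S = prod_list (map \<eta> (sorted_list_of_set S))"

lemma ext_coeff_simps [simp]:
  "ext_coeff 0 S = 0"
  "ext_coeff (u + v) S = ext_coeff u S + ext_coeff v S"
  "ext_coeff (u - v) S = ext_coeff u S - ext_coeff v S"
  "ext_coeff (- u) S = - ext_coeff u S"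
  "ext_coeff (r *\<^sub>E u) S = r * ext_coeff u S"
  by (transfer; simp)+

lemma ext_coeff_sum [simp]: "ext_coeff (sum f A) S = (\<Sum>a\<in>A. ext_coeff (f a) S)"
  by (induction A rule: infinite_finite_induct) auto

lemma module_ext_scale: "module (*\<^sub>E)"
  by unfold_locales (auto intro!: exterior_eqI simp: algebra_simps)

lemma ext_scale_mult_left: "(r *\<^sub>E u) * v = r *\<^sub>E (u * v)"
  by (rule exterior_eqI) (simp add: times_exterior.rep_eq sum_distrib_left mult.assoc mult.left_commute)

lemma ext_scale_mult_right: "u * (r *\<^sub>E v) = r *\<^sub>E (u * v)"
  by (rule exterior_eqI) (simp add: times_exterior.rep_eq sum_distrib_left mult.assoc mult.left_commute)

lemma ext_coeff_dx_mult:
  "ext_coeff (dx i * u) S = (if i \<in> S then (- 1) ^ card {k \<in> S. k < i} * ext_coeff u (S - {i}) else 0)"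
proof -
  have "ext_coeff (dx i * u) S =
    (\<Sum>T\<in>Pow S. if T = {i} then shuffle_sign T (S - T) * ext_coeff u (S - T) else 0)"
    unfolding times_exterior.rep_eq dx.rep_eq by (intro sum.cong) auto
  also have "\<dots> = (if i \<in> S then shuffle_sign {i} (S - {i}) * ext_coeff u (S - {i}) else 0)"
    by (subst sum.delta) auto
  moreover have "{t \<in> S - {i}. t < i} = {t \<in> S. t < i}" by auto
  ultimately show ?thesis by (simp add: shuffle_sign_singleton)
qed

lemma dx_sq: "dx i * dx i = 0"
  by (rule exterior_eqI) (auto simp: ext_coeff_dx_mult dx.rep_eq)

lemma dx_anticomm: "dx i * dx j = - (dx j * dx i :: ('r::comm_ring_1, 'n::{finite,linorder}) exterior)"
proof (cases "i = j")
  case True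
  then show ?thesis by (simp add: dx_sq)
next
  case False
  have i: "{k. (k = i \<or> k = j) \<and> k < i} = (if j < i then {j} else {})" for i j :: 'n by auto
  show ?thesis
  proof (rule exterior_eqI)
    fix S :: "'n set"
    have "ext_coeff (dx i * dx j :: ('r, 'n) exterior) S =
      (if S = {i, j} then if j < i then - 1 else 1 else 0)"
      if "i \<noteq> j" for i j
    proof (cases "S = {i, j}")
      case True
      with that show ?thesis by (auto simp: ext_coeff_dx_mult dx.rep_eq i insert_commute)
    next
      case False
      with that show ?thesis by (auto simp: ext_coeff_dx_mult dx.rep_eq)
    qed
    from this[of i j] this[of j i] False
    show "ext_coeff (dx i * dx j) S = ext_coeff (- (dx j * dx i) :: ('r, 'n) exterior) S"
      by (auto simp: insert_commute)
  qed
qed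

lemma ordered_prod_empty [simp]: "ordered_prod \<eta> {} = 1"
  by (simp add: ordered_prod_def)

lemma ordered_prod_insert_min:
  assumes "\<And>s. s \<in> S \<Longrightarrow> i < s"
  shows "ordered_prod \<eta> (insert i S) = \<eta> i * ordered_prod \<eta> S"
proof -
  have "i \<notin> S" using assms by auto
  moreover have "insort i (sorted_list_of_set S) = i # sorted_list_of_set S"
    by (rule insort_is_Cons) (use assms in \<open>auto intro: less_imp_le\<close>)
  ultimately show ?thesis by (simp add: ordered_prod_def sorted_list_of_set_insert)
qed

lemma ordered_prod_dx:
  "ext_coeff (ordered_prod dx S) T = (if T = S then 1 else 0 :: 'r::comm_ring_1)"
proof -
  have "finite S" by simp
  then show ?thesis
  proof (induction S arbitrary: T rule: finite_linorder_min_induct)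
    case empty
    then show ?case by (simp add: one_exterior.rep_eq)
  next
    case (insert i S)
    have "ext_coeff (ordered_prod dx (insert i S)) T = (ext_coeff (dx i * ordered_prod dx S) T :: 'r)"
      using insert by (subst ordered_prod_insert_min) auto
    also have "\<dots> = (if i \<in> T then (- 1) ^ card {k \<in> T. k < i} * (if T - {i} = S then 1 else 0) else 0)"
      by (simp only: ext_coeff_dx_mult insert.IH)
    also have "\<dots> = (if T = insert i S then 1 else 0)"
    proof (cases "T = insert i S")
      case True
      have "i \<notin> S" using insert by auto
      moreover have "{k \<in> insert i S. k < i} = {}" using insert by auto
      ultimately show ?thesis unfolding True by (simp only: card.empty) simp
    next
      case False
      then have "\<not> (i \<in> T \<and> T - {i} = S)" by (metis insert_Diff)
      with False show ?thesis by (simp only: if_False) simp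
    qed
    finally show ?case .
  qed
qed

lemma exterior_expand: "u = (\<Sum>S\<in>UNIV. ext_coeff u S *\<^sub>E ordered_prod dx S)"
  by (rule exterior_eqI) (simp add: ordered_prod_dx if_distrib cong: if_cong)

section \<open>Polynomials\<close>

type_synonym ('a, 'n) mpoly = "('n \<Rightarrow>\<^sub>0 nat) \<Rightarrow>\<^sub>0 'a"

definition mvar :: "'n \<Rightarrow> ('a::comm_ring_1, 'n) mpoly" where
  "mvar i = Poly_Mapping.single (Poly_Mapping.single i 1) 1"

definition mconst :: "'a \<Rightarrow> ('a::comm_ring_1, 'n) mpoly" where
  "mconst c = Poly_Mapping.single 0 c"

definition mpoly_subst ::
  "('n::finite \<Rightarrow> ('a::comm_ring_1, 'n) mpoly) \<Rightarrow> ('a, 'n) mpoly \<Rightarrow> ('a, 'n) mpoly" where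
  "mpoly_subst \<sigma> f =
    (\<Sum>m\<in>Poly_Mapping.keys f. mconst (Poly_Mapping.lookup f m) * (\<Prod>i\<in>UNIV. \<sigma> i ^ Poly_Mapping.lookup m i))"

section \<open>The action of the general linear group\<close>

text \<open>
  \<open>('a, 'n) poly_ext\<close> is \<open>P\<^sub>n \<otimes> E\<^sub>n\<close> with \<open>n = CARD('n)\<close>, realised as the exterior algebra
  over \<open>P\<^sub>n\<close> on the \<open>dx i\<close>; since \<open>deg (mvar i) = 2\<close> is even, this is the graded tensor product.
\<close>

type_synonym ('a, 'n) poly_ext = "(('a, 'n) mpoly, 'n) exterior"

type_synonym ('a, 'n) sq_matrix = "(('a, 'n) vec, 'n) vec"

definition GL :: "('a::field, 'n::finite) sq_matrix set" where
  "GL = {g. invertible g}"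

text \<open>
  The algebra automorphism with \<open>x\<^sub>i\<close> and \<open>dx\<^sub>i\<close> sent to the combinations with coefficients from row
  \<open>i\<close> of \<open>g\<^sup>-\<^sup>1\<close>; see \<open>ext_act_mult\<close>, \<open>poly_act_mvar\<close> and \<open>ext_act_dx\<close> below.
\<close>

definition poly_act :: "('a::field, 'n::finite) sq_matrix \<Rightarrow> ('a, 'n) mpoly \<Rightarrow> ('a, 'n) mpoly" where
  "poly_act g = mpoly_subst (\<lambda>i. \<Sum>j\<in>UNIV. mconst (matrix_inv g $ i $ j) * mvar j)"

definition dx_act :: "('a::field, 'n::{finite,linorder}) sq_matrix \<Rightarrow> 'n \<Rightarrow> ('a, 'n) poly_ext" where
  "dx_act g i = (\<Sum>j\<in>UNIV. mconst (matrix_inv g $ i $ j) *\<^sub>E dx j)"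

definition ext_act ::
  "('a::field, 'n::{finite,linorder}) sq_matrix \<Rightarrow> ('a, 'n) poly_ext \<Rightarrow> ('a, 'n) poly_ext" where
  "ext_act g u = (\<Sum>S\<in>UNIV. poly_act g (ext_coeff u S) *\<^sub>E ordered_prod (dx_act g) S)"

definition poly_invariants :: "('a::field, 'n::{finite,linorder}) mpoly set" where
  "poly_invariants = {f. \<forall>g\<in>GL. poly_act g f = f}"

definition ext_invariants :: "('a::field, 'n::{finite,linorder}) poly_ext set" where
  "ext_invariants = {u. \<forall>g\<in>GL. ext_act g u = u}"

section \<open>Milnor operations\<close>

text \<open>
  On a monomial \<open>dx i\<^sub>1 * \<dots> * dx i\<^sub>r\<close> with increasing indices, the derivation property forces
  \<open>Q\<^sub>j (dx i\<^sub>1 * \<dots> * dx i\<^sub>r) = (\<Sum>k. (-1)\<^sup>k\<^sup>-\<^sup>1 x\<^sub>i\<^sub>k^(q^j) dx i\<^sub>1 * \<dots> * dx i\<^sub>r)\<close> with the factor \<open>dx i\<^sub>k\<close> omitted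
  from the \<open>k\<close>-th summand, where \<open>q = CARD('a)\<close>; the definition reads off the coefficient of
  each monomial.  See \<open>milnor_scale\<close>, \<open>milnor_dx\<close>, \<open>milnor_poly\<close> and \<open>milnor_derivation\<close> below for
  the characterising properties.
\<close>

lift_definition milnor ::
  "nat \<Rightarrow> ('a::{field,finite}, 'n::{finite,linorder}) poly_ext \<Rightarrow> ('a, 'n) poly_ext"
  is "\<lambda>j u S. \<Sum>i\<in>- S. (- 1) ^ card {k \<in> S. k < i} * mvar i ^ (CARD('a) ^ j) * u (insert i S)" .

definition milnor_set ::
  "nat set \<Rightarrow> ('a::{field,finite}, 'n::{finite,linorder}) poly_ext \<Rightarrow> ('a, 'n) poly_ext" where
  "milnor_set I = foldr milnor (sorted_list_of_set I)"

definition dx_top :: "('a::{field,finite}, 'n::{finite,linorder}) poly_ext" where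
  "dx_top = ordered_prod dx UNIV"

text \<open>An element of exterior degree \<open>0\<close>, that is, of \<open>P\<^sub>n\<close> inside \<open>P\<^sub>n \<otimes> E\<^sub>n\<close>.\<close>

definition e_elt :: "('a::{field,finite}, 'n::{finite,linorder}) poly_ext" where
  "e_elt = milnor_set {..<CARD('n)} dx_top"

section \<open>Free modules\<close>

text \<open>
  \<open>R\<close> is a subring of the ring of scalars, \<open>M\<close> is an \<open>R\<close>-submodule of the ambient module, and
  every element of \<open>M\<close> is an \<open>R\<close>-linear combination of \<open>B \<subseteq> M\<close> in exactly one way.
\<close>

definition free_module_with_basis ::
  "('r::comm_ring_1 \<Rightarrow> 'm::ab_group_add \<Rightarrow> 'm) \<Rightarrow> 'r set \<Rightarrow> 'm set \<Rightarrow> 'm set \<Rightarrow> bool" where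
  "free_module_with_basis sm R M B \<longleftrightarrow>
    module sm \<and>
    1 \<in> R \<and> (\<forall>a\<in>R. \<forall>b\<in>R. a - b \<in> R \<and> a * b \<in> R) \<and>
    0 \<in> M \<and> (\<forall>u\<in>M. \<forall>v\<in>M. u + v \<in> M) \<and> (\<forall>a\<in>R. \<forall>u\<in>M. sm a u \<in> M) \<and>
    B \<subseteq> M \<and>
    (\<forall>u\<in>M. \<exists>!c. finite {b. c b \<noteq> 0} \<and> {b. c b \<noteq> 0} \<subseteq> B \<and> c ` B \<subseteq> R \<and>
      u = (\<Sum>b | c b \<noteq> 0. sm (c b) b))"

section \<open>Characterising properties of the action and of the Milnor operations\<close>

lemma milnor_add: "milnor j (u + v) = milnor j u + milnor j v"
  by (rule exterior_eqI) (simp add: milnor.rep_eq algebra_simps sum.distrib)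

lemma milnor_scale: "milnor j (f *\<^sub>E u) = f *\<^sub>E milnor j u"
  by (rule exterior_eqI) (simp add: milnor.rep_eq sum_distrib_left mult.assoc mult.left_commute)

lemma milnor_zero [simp]: "milnor j 0 = 0"
  by (rule exterior_eqI) (simp add: milnor.rep_eq)

lemma milnor_uminus: "milnor j (- u) = - milnor j u"
  by (rule exterior_eqI) (simp add: milnor.rep_eq sum_negf)

lemma milnor_diff: "milnor j (u - v) = milnor j u - milnor j v"
  by (rule exterior_eqI) (simp add: milnor.rep_eq algebra_simps sum_subtractf)

lemma milnor_one [simp]: "milnor j 1 = 0"
  by (rule exterior_eqI) (simp add: milnor.rep_eq one_exterior.rep_eq)

lemma milnor_sum: "milnor j (sum f A) = (\<Sum>a\<in>A. milnor j (f a))"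
  by (induction A rule: infinite_finite_induct) (auto simp: milnor_add)

lemma milnor_poly: "milnor j (f *\<^sub>E 1) = 0"
  by (simp add: milnor_scale) (rule exterior_eqI, simp)

lemma neg_mult_rearrange:
  fixes a b c d y w :: "'r::comm_ring_1"
  assumes "a * b = - (c * d)"
  shows "a * (b * y * w) = - (c * y * (d * w))"
proof -
  have "a * (b * y * w) = (a * b) * (y * w)" by (simp only: mult.assoc)
  also have "\<dots> = - (c * y * (d * w))" unfolding assms by (simp add: mult_ac)
  finally show ?thesis .
qed

lemma milnor_dx_mult:
  fixes u :: "('a::{field,finite}, 'n::{finite,linorder}) poly_ext"
  shows "milnor j (dx i * u) = mvar i ^ (CARD('a) ^ j) *\<^sub>E u - dx i * milnor j u"
proof (rule exterior_eqI)
  fix S :: "'n set"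
  let ?y = "\<lambda>i. mvar i ^ (CARD('a) ^ j) :: ('a, 'n) mpoly"
  let ?c = "\<lambda>i (S::'n set). card {k \<in> S. k < i}"
  let ?e = "\<lambda>i (S::'n set). (- 1) ^ ?c i S :: ('a, 'n) mpoly"
  have sq: "?e i S * (?e i S * w) = w" for i S w
    by (simp flip: mult.assoc power_add)
  have ins: "{k. (k = i \<or> k \<in> S) \<and> k < i} = {k \<in> S. k < i}" for i and S :: "'n set" by auto
  have del: "{k. k \<in> S \<and> k \<noteq> i \<and> k < i} = {k \<in> S. k < i}" for i and S :: "'n set" by auto
  show "ext_coeff (milnor j (dx i * u)) S =
    ext_coeff (?y i *\<^sub>E u - dx i * milnor j u) S"
  proof (cases "i \<in> S")
    case False
    have "ext_coeff (milnor j (dx i * u)) S =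
      (\<Sum>k\<in>- S. if k = i then ?y i * ext_coeff u S else 0)"
      unfolding milnor.rep_eq
    proof (rule sum.cong)
      fix k assume "k \<in> - S"
      show "?e k S * ?y k * ext_coeff (dx i * u) (insert k S) =
        (if k = i then ?y i * ext_coeff u S else 0)"
        using False by (auto simp: ext_coeff_dx_mult ins sq mult.left_commute mult.assoc)
    qed simp
    also have "\<dots> = ?y i * ext_coeff u S" using False by (subst sum.delta) auto
    finally show ?thesis using False by (simp add: ext_coeff_dx_mult)
  next
    case True
    have "ext_coeff (dx i * milnor j u) S =
      ?e i S * (\<Sum>k\<in>insert i (- S). ?e k (S - {i}) * ?y k * ext_coeff u (insert k (S - {i})))"
      using True by (simp add: ext_coeff_dx_mult milnor.rep_eq Compl_insert flip: Compl_Diff_eq)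
         (simp add: Un_commute)
    also have "\<dots> = ?y i * ext_coeff u S +
      (\<Sum>k\<in>- S. ?e i S * (?e k (S - {i}) * ?y k * ext_coeff u (insert k (S - {i}))))"
      using True
      by (subst sum.insert)
        (auto simp: distrib_left del sq insert_absorb sum_distrib_left mult.assoc)
    also have "(\<Sum>k\<in>- S. ?e i S * (?e k (S - {i}) * ?y k * ext_coeff u (insert k (S - {i})))) =
      (\<Sum>k\<in>- S. - (?e k S * ?y k * ext_coeff (dx i * u) (insert k S)))"
    proof (rule sum.cong)
      fix k assume k: "k \<in> - S"
      then have ne: "k \<noteq> i" using True by auto
      have eq: "insert k S - {i} = insert k (S - {i})" using ne by auto
      have "?e i S * ?e k (S - {i}) = - (?e k S * ?e i (insert k S))"
      proof (cases "k < i")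
        case less: True
        have "{m \<in> insert k S. m < i} = insert k {m \<in> S. m < i}" using less by auto
        then have "?c i (insert k S) = Suc (?c i S)" using k by simp
        moreover have "{m \<in> S - {i}. m < k} = {m \<in> S. m < k}" using less by auto
        ultimately show ?thesis by (simp add: mult.commute)
      next
        case False
        then have gt: "i < k" using ne by auto
        have "{m \<in> insert k S. m < i} = {m \<in> S. m < i}" using gt by auto
        moreover have "{m \<in> S. m < k} = insert i {m \<in> S - {i}. m < k}" using gt True by auto
        then have "?c k S = Suc (?c k (S - {i}))" by simp
        ultimately show ?thesis by (simp add: mult.commute)
      qed
      note sgn = neg_mult_rearrange[OF this]
      have ik: "i \<in> insert k S" using True by simp
      show "?e i S * (?e k (S - {i}) * ?y k * ext_coeff u (insert k (S - {i}))) =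
        - (?e k S * ?y k * ext_coeff (dx i * u) (insert k S))"
        unfolding ext_coeff_dx_mult if_P[OF ik] eq by (rule sgn)
    qed simp
    finally show ?thesis by (simp add: milnor.rep_eq sum_negf)
  qed
qed

lemma milnor_dx: "milnor j (dx i :: ('a::{field,finite}, 'n::{finite,linorder}) poly_ext)
    = mvar i ^ (CARD('a) ^ j) *\<^sub>E 1"
  using milnor_dx_mult[of j i 1] by simp

lemma milnor_derivation_monomial:
  fixes v :: "('a::{field,finite}, 'n::{finite,linorder}) poly_ext"
  shows "milnor j (ordered_prod dx S * v) =
    milnor j (ordered_prod dx S) * v + (- 1) ^ card S * ordered_prod dx S * milnor j v"
proof -
  have "finite S" by simp
  then show ?thesis
  proof (induction S rule: finite_linorder_min_induct)
    case empty
    then show ?case by simp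
  next
    case (insert i S)
    have op: "ordered_prod dx (insert i S) = dx i * ordered_prod dx S"
      for dx :: "'n \<Rightarrow> ('a, 'n) poly_ext"
      by (rule ordered_prod_insert_min) (use insert in auto)
    have i: "i \<notin> S" using insert by auto
    have comm: "dx i * ((- 1) ^ k * w) = (- 1) ^ k * (dx i * w)" for k and w :: "('a, 'n) poly_ext"
      by (cases "even k") auto
    show ?case
      using i by (simp add: op mult.assoc milnor_dx_mult insert.IH left_diff_distrib
          ext_scale_mult_left distrib_left comm)
  qed
qed

text \<open>Since the \<open>mvar i\<close> have even degree, \<open>(- 1)\<^sup>r\<close> is the sign \<open>(- 1)\<^sup>d\<^sup>e\<^sup>g \<^sup>u\<close> in the following.\<close>

lemma milnor_derivation:
  fixes u v :: "('a::{field,finite}, 'n::{finite,linorder}) poly_ext"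
  assumes "\<And>S. ext_coeff u S \<noteq> 0 \<Longrightarrow> card S = r"
  shows "milnor j (u * v) = milnor j u * v + (- 1) ^ r * u * milnor j v"
proof -
  have *: "milnor j ((ext_coeff u S *\<^sub>E ordered_prod dx S) * v) =
    milnor j (ext_coeff u S *\<^sub>E ordered_prod dx S) * v +
    (- 1) ^ r * (ext_coeff u S *\<^sub>E ordered_prod dx S) * milnor j v" for S
  proof (cases "ext_coeff u S = 0")
    case True
    interpret module "(*\<^sub>E) :: ('a, 'n) mpoly \<Rightarrow> ('a, 'n) poly_ext \<Rightarrow> _" by (rule module_ext_scale)
    from True show ?thesis by simp
  next
    case False
    interpret module "(*\<^sub>E) :: ('a, 'n) mpoly \<Rightarrow> ('a, 'n) poly_ext \<Rightarrow> _" by (rule module_ext_scale)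
    from False assms have "card S = r" by blast
    then show ?thesis
      by (simp add: ext_scale_mult_left ext_scale_mult_right milnor_scale milnor_derivation_monomial
          scale_right_distrib)
  qed
  show ?thesis
    by (subst (1 2 3) exterior_expand[of u])
      (simp only: milnor_sum sum_distrib_left sum_distrib_right * sum.distrib)
qed

lemma mpoly_subst_superset:
  assumes "finite A" "Poly_Mapping.keys f \<subseteq> A"
  shows "mpoly_subst \<sigma> f =
    (\<Sum>m\<in>A. mconst (Poly_Mapping.lookup f m) * (\<Prod>i\<in>UNIV. \<sigma> i ^ Poly_Mapping.lookup m i))"
  unfolding mpoly_subst_def
  by (rule sum.mono_neutral_left) (use assms in \<open>auto simp: in_keys_iff mconst_def\<close>)

lemma mconst_add: "mconst (a + b) = mconst a + mconst b"
  by (simp add: mconst_def single_add)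

lemma mconst_mult: "mconst (a * b) = mconst a * mconst b"
  by (simp add: mconst_def mult_single)

lemma mconst_one [simp]: "mconst 1 = 1"
  by (simp add: mconst_def)

lemma mpoly_subst_add: "mpoly_subst \<sigma> (f + g) = mpoly_subst \<sigma> f + mpoly_subst \<sigma> g"
proof -
  let ?A = "Poly_Mapping.keys f \<union> Poly_Mapping.keys g"
  have "Poly_Mapping.keys (f + g) \<subseteq> ?A" by (rule Poly_Mapping.keys_add)
  then show ?thesis
    by (simp add: mpoly_subst_superset[of ?A] lookup_add mconst_add distrib_right sum.distrib)
qed

lemma mpoly_subst_zero [simp]: "mpoly_subst \<sigma> 0 = 0"
  by (simp add: mpoly_subst_def)

lemma mpoly_subst_sum: "mpoly_subst \<sigma> (sum f A) = (\<Sum>a\<in>A. mpoly_subst \<sigma> (f a))"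
  by (induction A rule: infinite_finite_induct) (auto simp: mpoly_subst_add)

lemma mpoly_subst_single:
  "mpoly_subst \<sigma> (Poly_Mapping.single m c) = mconst c * (\<Prod>i\<in>UNIV. \<sigma> i ^ Poly_Mapping.lookup m i)"
  by (subst mpoly_subst_superset[of "{m}"]) auto

lemma mpoly_expand: "f = (\<Sum>m\<in>Poly_Mapping.keys f. Poly_Mapping.single m (Poly_Mapping.lookup f m))"
proof (rule poly_mapping_eqI)
  fix k
  show "Poly_Mapping.lookup f k = Poly_Mapping.lookup
    (\<Sum>m\<in>Poly_Mapping.keys f. Poly_Mapping.single m (Poly_Mapping.lookup f m)) k"
    by (auto simp: lookup_sum lookup_single when_def in_keys_iff)
qed

lemma mpoly_subst_mult: "mpoly_subst \<sigma> (f * g) = mpoly_subst \<sigma> f * mpoly_subst \<sigma> g"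
proof -
  have *: "mpoly_subst \<sigma> (Poly_Mapping.single m a * Poly_Mapping.single k b) =
    mpoly_subst \<sigma> (Poly_Mapping.single m a) * mpoly_subst \<sigma> (Poly_Mapping.single k b)" for m k a b
    by (simp add: mult_single mpoly_subst_single mconst_mult lookup_add power_add prod.distrib mult_ac)
  show ?thesis
    by (subst (1 2) mpoly_expand[of f], subst (1 2) mpoly_expand[of g])
      (simp only: sum_product mpoly_subst_sum *)
qed

lemma mpoly_subst_one [simp]: "mpoly_subst \<sigma> 1 = 1"
  using mpoly_subst_single[of \<sigma> 0 1] by simp

lemma mpoly_subst_mconst [simp]: "mpoly_subst \<sigma> (mconst c) = mconst c"
  unfolding mconst_def by (subst mpoly_subst_single) (simp add: mconst_def)

lemma mpoly_subst_mvar [simp]: "mpoly_subst \<sigma> (mvar i) = \<sigma> i"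
proof -
  have "(\<Prod>k\<in>UNIV. \<sigma> k ^ Poly_Mapping.lookup (Poly_Mapping.single i 1) k) =
    (\<Prod>k\<in>UNIV. if k = i then \<sigma> i else 1)"
    by (rule prod.cong) (auto simp: lookup_single when_def)
  then show ?thesis by (simp add: mvar_def mpoly_subst_single)
qed

text \<open>The ordered monomials in any anticommuting elements multiply like those in the \<open>dx i\<close>.\<close>

lemma ordered_prod_insert:
  fixes \<eta> :: "'n::{finite,linorder} \<Rightarrow> 'm::ring_1"
  assumes sq: "\<And>i. \<eta> i * \<eta> i = 0" and anti: "\<And>i j. \<eta> i * \<eta> j = - (\<eta> j * \<eta> i)"
  shows "\<eta> i * ordered_prod \<eta> S =
    (if i \<in> S then 0 else (- 1) ^ card {k \<in> S. k < i} * ordered_prod \<eta> (insert i S))"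
proof -
  have "finite S" by simp
  then show ?thesis
  proof (induction S rule: finite_linorder_min_induct)
    case empty
    have "ordered_prod \<eta> {i} = \<eta> i" by (subst ordered_prod_insert_min) auto
    then show ?case by simp
  next
    case (insert k S)
    have k: "ordered_prod \<eta> (insert k S) = \<eta> k * ordered_prod \<eta> S"
      by (rule ordered_prod_insert_min) (use insert in auto)
    consider "i < k" | "i = k" | "k < i" by fastforce
    then show ?case
    proof cases
      case 1
      have "{m \<in> insert k S. m < i} = {}" "i \<notin> insert k S" using 1 insert by auto
      moreover have "ordered_prod \<eta> (insert i (insert k S)) = \<eta> i * ordered_prod \<eta> (insert k S)"
        by (rule ordered_prod_insert_min) (use insert 1 in \<open>auto intro: less_trans\<close>)
      ultimately show ?thesis by (simp only: card.empty) simp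
    next
      case 2
      then show ?thesis by (simp add: k sq flip: mult.assoc)
    next
      case 3
      have "\<eta> i * ordered_prod \<eta> (insert k S) = - (\<eta> k * (\<eta> i * ordered_prod \<eta> S))"
        by (simp add: k anti[of i k] flip: mult.assoc)
      also have "\<dots> = (if i \<in> S then 0 else
        - ((- 1) ^ card {m \<in> S. m < i} * (\<eta> k * ordered_prod \<eta> (insert i S))))"
        unfolding insert.IH by (cases "even (card {m \<in> S. m < i})") auto
      also have "\<eta> k * ordered_prod \<eta> (insert i S) = ordered_prod \<eta> (insert k (insert i S))"
        by (rule ordered_prod_insert_min[symmetric]) (use insert 3 in auto)
      also have "{m \<in> insert k S. m < i} = insert k {m \<in> S. m < i}" using 3 by auto
      then have "card {m \<in> insert k S. m < i} = Suc (card {m \<in> S. m < i})"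
        using insert by (simp add: card_insert_if) auto
      ultimately show ?thesis using 3 by (auto simp: insert_commute)
    qed
  qed
qed

lemma ordered_prod_mult:
  fixes \<eta> :: "'n::{finite,linorder} \<Rightarrow> ('r::comm_ring_1, 'n) exterior"
  assumes sq: "\<And>i. \<eta> i * \<eta> i = 0" and anti: "\<And>i j. \<eta> i * \<eta> j = - (\<eta> j * \<eta> i)"
  shows "ordered_prod \<eta> S * ordered_prod \<eta> T =
    (if S \<inter> T = {} then shuffle_sign S T *\<^sub>E ordered_prod \<eta> (S \<union> T) else 0)"
proof -
  interpret module "(*\<^sub>E) :: 'r \<Rightarrow> ('r, 'n) exterior \<Rightarrow> _" by (rule module_ext_scale)
  have pow: "(- 1) ^ k * u = ((- 1) ^ k :: 'r) *\<^sub>E u" for k and u :: "('r, 'n) exterior"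
    by (cases "even k") auto
  have "finite S" by simp
  then show ?thesis
  proof (induction S rule: finite_linorder_min_induct)
    case empty
    then show ?case by simp
  next
    case (insert i S)
    have i: "i \<notin> S" using insert by auto
    have op: "ordered_prod \<eta> (insert i S) = \<eta> i * ordered_prod \<eta> S"
      by (rule ordered_prod_insert_min) (use insert in auto)
    have sgn: "shuffle_sign (insert i S) T = (shuffle_sign S T * (- 1) ^ card {t \<in> T. t < i} :: 'r)"
      using shuffle_sign_Un_left[of "{i}" S T] i by (simp add: shuffle_sign_singleton mult.commute)
    have set: "{k \<in> S \<union> T. k < i} = {t \<in> T. t < i}" using insert by auto
    have mult: "ordered_prod \<eta> (insert i S) * ordered_prod \<eta> T =
      \<eta> i * (if S \<inter> T = {} then shuffle_sign S T *\<^sub>E ordered_prod \<eta> (S \<union> T) else 0)"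
      by (simp only: op mult.assoc insert.IH)
    show ?case
    proof (cases "S \<inter> T = {}")
      case False
      then show ?thesis unfolding mult by auto
    next
      case True
      then have "ordered_prod \<eta> (insert i S) * ordered_prod \<eta> T =
        shuffle_sign S T *\<^sub>E (\<eta> i * ordered_prod \<eta> (S \<union> T))"
        unfolding mult by (simp only: if_True simp_thms ext_scale_mult_right)
      also have "\<dots> = (if i \<in> T then 0 else
        (shuffle_sign S T * (- 1) ^ card {t \<in> T. t < i}) *\<^sub>E ordered_prod \<eta> (insert i (S \<union> T)))"
        unfolding ordered_prod_insert[of \<eta>, OF sq anti] set pow using i by simp
      finally show ?thesis using True by (simp add: sgn)
    qed
  qed
qed

lemma dx_act_anticomm:
  fixes g :: "('a::field, 'n::{finite,linorder}) sq_matrix"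
  shows "dx_act g i * dx_act g j = - (dx_act g j * dx_act g i)"
proof -
  have "dx_act g i * dx_act g j = (\<Sum>k\<in>UNIV. \<Sum>l\<in>UNIV.
      mconst (matrix_inv g $ j $ l) *\<^sub>E mconst (matrix_inv g $ i $ k) *\<^sub>E (dx k * dx l))"
    by (simp add: dx_act_def sum_product ext_scale_mult_left ext_scale_mult_right)
  also have "\<dots> = (\<Sum>k\<in>UNIV. \<Sum>l\<in>UNIV.
      - (mconst (matrix_inv g $ i $ k) *\<^sub>E mconst (matrix_inv g $ j $ l) *\<^sub>E (dx l * dx k)))"
  proof (intro sum.cong refl)
    fix k l :: 'n
    show "mconst (matrix_inv g $ j $ l) *\<^sub>E mconst (matrix_inv g $ i $ k) *\<^sub>E (dx k * dx l) =
      - (mconst (matrix_inv g $ i $ k) *\<^sub>E mconst (matrix_inv g $ j $ l) *\<^sub>E (dx l * dx k))"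
      by (subst dx_anticomm) (auto intro!: exterior_eqI)
  qed
  also have "\<dots> = - (\<Sum>k\<in>UNIV. \<Sum>l\<in>UNIV.
      mconst (matrix_inv g $ i $ k) *\<^sub>E mconst (matrix_inv g $ j $ l) *\<^sub>E (dx l * dx k))"
    by (simp add: sum_negf)
  also have "\<dots> = - (dx_act g j * dx_act g i)"
    by (subst sum.swap)
      (simp add: dx_act_def sum_product ext_scale_mult_left ext_scale_mult_right)
  finally show ?thesis .
qed

text \<open>Characteristic 2 is not excluded here, so this does not follow from anticommutativity.\<close>

lemma sum_dx_sq:
  fixes a :: "'n::{finite,linorder} \<Rightarrow> 'r::comm_ring_1"
  shows "(\<Sum>k\<in>A. a k *\<^sub>E dx k) * (\<Sum>k\<in>A. a k *\<^sub>E dx k) = 0"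
proof (induction A rule: infinite_finite_induct)
  case (insert i A)
  let ?s = "\<Sum>k\<in>A. a k *\<^sub>E (dx k :: ('r, 'n) exterior)"
  have "(a i *\<^sub>E dx i) * ?s = (\<Sum>k\<in>A. - ((a k *\<^sub>E dx k) * (a i *\<^sub>E dx i)))"
    unfolding sum_distrib_left
  proof (rule sum.cong)
    fix k
    show "(a i *\<^sub>E dx i) * (a k *\<^sub>E dx k) = - ((a k *\<^sub>E dx k) * (a i *\<^sub>E dx i))"
      by (simp add: ext_scale_mult_left ext_scale_mult_right)
        (subst dx_anticomm, auto intro!: exterior_eqI)
  qed simp
  also have "\<dots> = - (?s * (a i *\<^sub>E dx i))"
    by (simp add: sum_negf sum_distrib_right)
  moreover have "(a i *\<^sub>E dx i) * (a i *\<^sub>E dx i) = 0"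
    by (simp add: ext_scale_mult_left ext_scale_mult_right dx_sq) (auto intro!: exterior_eqI)
  ultimately show ?case using insert by (simp add: distrib_left distrib_right)
qed auto

lemma dx_act_sq: "dx_act g i * dx_act g i = 0"
  unfolding dx_act_def by (rule sum_dx_sq)

lemma poly_act_mult: "poly_act g (f * h) = poly_act g f * poly_act g h"
  by (simp add: poly_act_def mpoly_subst_mult)

lemma poly_act_mvar: "poly_act g (mvar i) = (\<Sum>j\<in>UNIV. mconst (matrix_inv g $ i $ j) * mvar j)"
  by (simp add: poly_act_def)

lemma ext_act_add:
  fixes g :: "('a::field, 'n::{finite,linorder}) sq_matrix"
  shows "ext_act g (u + v) = ext_act g u + ext_act g v"
proof -
  interpret module "(*\<^sub>E) :: ('a, 'n) mpoly \<Rightarrow> ('a, 'n) poly_ext \<Rightarrow> _" by (rule module_ext_scale)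
  show ?thesis
    by (simp add: ext_act_def poly_act_def mpoly_subst_add scale_left_distrib sum.distrib)
qed

lemma ext_act_sum: "ext_act g (sum f A) = (\<Sum>a\<in>A. ext_act g (f a))"
proof -
  have "ext_act g 0 = 0"
    by (rule exterior_eqI) (simp add: ext_act_def poly_act_def)
  then show ?thesis
    by (induction A rule: infinite_finite_induct) (auto simp: ext_act_add)
qed

lemma ext_act_monomial:
  "ext_act g (f *\<^sub>E ordered_prod dx S) = poly_act g f *\<^sub>E ordered_prod (dx_act g) S"
proof -
  have "ext_act g (f *\<^sub>E ordered_prod dx S) =
    (\<Sum>T\<in>UNIV. if T = S then poly_act g f *\<^sub>E ordered_prod (dx_act g) S else 0)"
    unfolding ext_act_def
    by (intro sum.cong) (auto simp: ordered_prod_dx poly_act_def intro!: exterior_eqI)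
  then show ?thesis by simp
qed

lemma ext_act_poly: "ext_act g (f *\<^sub>E 1) = poly_act g f *\<^sub>E 1"
  using ext_act_monomial[of g f "{}"] by simp

lemma ext_act_const: "ext_act g (mconst c *\<^sub>E 1) = mconst c *\<^sub>E 1"
  by (simp add: ext_act_poly poly_act_def)

lemma ext_act_dx:
  fixes g :: "('a::field, 'n::{finite,linorder}) sq_matrix"
  shows "ext_act g (dx i) = dx_act g i"
proof -
  interpret module "(*\<^sub>E) :: ('a, 'n) mpoly \<Rightarrow> ('a, 'n) poly_ext \<Rightarrow> _" by (rule module_ext_scale)
  have op: "ordered_prod \<eta> {i} = \<eta> i" for \<eta> :: "'n \<Rightarrow> ('a, 'n) poly_ext"
    by (subst ordered_prod_insert_min) auto
  show ?thesis using ext_act_monomial[of g 1 "{i}"] by (simp add: op poly_act_def)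
qed

lemma ext_act_mult:
  fixes g :: "('a::field, 'n::{finite,linorder}) sq_matrix"
  shows "ext_act g (u * v) = ext_act g u * ext_act g v"
proof -
  interpret module "(*\<^sub>E) :: ('a, 'n) mpoly \<Rightarrow> ('a, 'n) poly_ext \<Rightarrow> _" by (rule module_ext_scale)
  have sgn: "poly_act g (shuffle_sign S T) = shuffle_sign S T" for S T :: "'n set"
  proof -
    have "mpoly_subst \<sigma> (- 1) = (- 1 :: ('a, 'n) mpoly)" for \<sigma>
      using mpoly_subst_add[of \<sigma> 1 "- 1"] by (simp add: eq_neg_iff_add_eq_0 add.commute)
    then show ?thesis
      by (cases "even (card {(s, t). s \<in> S \<and> t \<in> T \<and> t < s})")
        (auto simp: shuffle_sign_def poly_act_def)
  qed
  have *: "ext_act g ((a *\<^sub>E ordered_prod dx S) * (b *\<^sub>E ordered_prod dx T)) =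
    ext_act g (a *\<^sub>E ordered_prod dx S) * ext_act g (b *\<^sub>E ordered_prod dx T)" for a b S T
  proof (cases "S \<inter> T = {}")
    case True
    have "(a *\<^sub>E ordered_prod dx S) * (b *\<^sub>E ordered_prod dx T) =
      (a * b * shuffle_sign S T) *\<^sub>E ordered_prod dx (S \<union> T)"
      using True by (simp add: ext_scale_mult_left ext_scale_mult_right
          ordered_prod_mult[of dx, OF dx_sq dx_anticomm] mult_ac)
    then show ?thesis
      using True by (simp add: ext_act_monomial ext_scale_mult_left ext_scale_mult_right
          ordered_prod_mult[of "dx_act g", OF dx_act_sq dx_act_anticomm] poly_act_mult sgn mult_ac)
  next
    case False
    then show ?thesis
      by (simp add: ext_act_monomial ext_scale_mult_left ext_scale_mult_right
          ordered_prod_mult[of dx, OF dx_sq dx_anticomm]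
          ordered_prod_mult[of "dx_act g", OF dx_act_sq dx_act_anticomm])
        (simp add: ext_act_def poly_act_def)
  qed
  show ?thesis
    by (subst (1 2) exterior_expand[of u], subst (1 2) exterior_expand[of v])
      (simp only: sum_product ext_act_sum *)
qed

end

theory Submission
  imports Defs
begin

text \<open>
  Let \<open>L\<close> be the polynomial underlying \<open>e_elt\<close>.  Since \<open>Q\<^sub>J Q\<^sub>I dx_top\<close> has constant term \<open>\<plusminus>L\<close> if \<open>J\<close> is
  the complement of \<open>I\<close> and \<open>0\<close> otherwise, the \<open>Q\<^sub>I dx_top\<close> are linearly independent over \<open>P\<^sub>n\<close>, and
  \<open>L u = \<Sum>\<^sub>I \<plusminus>f\<^sub>I Q\<^sub>I dx_top\<close> for every \<open>u\<close>, where \<open>f\<^sub>I\<close> is the constant term of \<open>Q\<^sub>J u\<close> for the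
  complement \<open>J\<close> of \<open>I\<close>.  The Milnor operations commute with the group because \<open>q\<close>-th powers are
  additive, so \<open>f\<^sub>I\<close> is invariant if \<open>u\<close> is.  It remains to divide \<open>f\<^sub>I\<close> by \<open>L^(q - 1)\<close> for proper
  \<open>I\<close>.  Invariance of \<open>u\<close> under transvections makes \<open>f\<^sub>I\<close> divisible by each \<open>x\<^sub>i\<close>, invariance of
  \<open>f\<^sub>I\<close> under diagonal matrices then gives \<open>x\<^sub>i^(q - 1)\<close>, hence the \<open>(q - 1)\<close>-th power of every
  linear form, and up to a scalar \<open>L\<close> is the product of these forms, one for each line.
\<close>

section \<open>Polynomials\<close>

abbreviation lookup where "lookup \<equiv> Poly_Mapping.lookup"
abbreviation keys where "keys \<equiv> Poly_Mapping.keys"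

definition lin :: "('a::comm_ring_1, 'n::finite) vec \<Rightarrow> ('a, 'n) mpoly" where
  "lin v = (\<Sum>j\<in>UNIV. mconst (v $ j) * mvar j)"

lemma mconst_zero [simp]: "mconst 0 = 0"
  by (simp add: mconst_def)

lemma mconst_uminus: "mconst (- a) = - mconst a"
  by (simp add: mconst_def single_uminus)

lemma mconst_sum: "mconst (sum f A) = (\<Sum>a\<in>A. mconst (f a))"
  by (induction A rule: infinite_finite_induct) (auto simp: mconst_add)

lemma mconst_power: "mconst (a ^ n) = mconst a ^ n"
  by (induction n) (auto simp: mconst_mult)

lemma mconst_neg_one_power: "mconst ((- 1) ^ n) = (- 1) ^ n"
  by (simp add: mconst_power mconst_uminus)

lemma mconst_eq_iff [simp]: "mconst a = mconst b \<longleftrightarrow> a = b"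
  by (metis mconst_def lookup_single_eq)

lemma lin_axis [simp]: "lin (axis i 1) = mvar i"
  by (simp add: lin_def axis_def if_distrib if_distribR cong: if_cong)

lemma lin_scale: "lin (c *s v) = mconst c * lin v"
  by (simp add: lin_def mconst_mult sum_distrib_left mult.assoc)

lemma lookup_single_mult:
  fixes f :: "('a::comm_ring_1, 'n) mpoly"
  shows "lookup (Poly_Mapping.single s c * f) m = (\<Sum>k\<in>keys f. (c * lookup f k when s + k = m))"
proof -
  have "Poly_Mapping.single s c * f = (\<Sum>k\<in>keys f. Poly_Mapping.single (s + k) (c * lookup f k))"
    by (subst mpoly_expand[of f]) (simp add: sum_distrib_left mult_single)
  then show ?thesis by (simp add: lookup_sum lookup_single)
qed

lemma lookup_single_mult_add:
  fixes f :: "('a::comm_ring_1, 'n) mpoly"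
  shows "lookup (Poly_Mapping.single s c * f) (s + m) = c * lookup f m"
proof -
  have "lookup (Poly_Mapping.single s c * f) (s + m) =
    (\<Sum>k\<in>keys f. if k = m then c * lookup f k else 0)"
    unfolding lookup_single_mult by (rule sum.cong) (auto simp: when_def)
  then show ?thesis by (auto simp: in_keys_iff)
qed

lemma mvar_power: "mvar i ^ k = Poly_Mapping.single (Poly_Mapping.single i k) 1"
proof (induction k)
  case (Suc k)
  then show ?case by (simp add: mvar_def mult_single flip: single_add)
qed simp

lemma mvar_power_dvd_iff:
  fixes f :: "('a::comm_ring_1, 'n) mpoly"
  shows "mvar i ^ k dvd f \<longleftrightarrow> (\<forall>m\<in>keys f. k \<le> lookup m i)"
proof
  assume "mvar i ^ k dvd f"
  then obtain h where f: "f = Poly_Mapping.single (Poly_Mapping.single i k) 1 * h"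
    by (auto simp: mvar_power)
  show "\<forall>m\<in>keys f. k \<le> lookup m i"
  proof
    fix m assume "m \<in> keys f"
    then have "m \<in> {a + b |a b. a \<in> keys (Poly_Mapping.single (Poly_Mapping.single i k) (1::'a)) \<and> b \<in> keys h}"
      unfolding f using keys_mult by blast
    then obtain b where "m = Poly_Mapping.single i k + b" by auto
    then show "k \<le> lookup m i" by (simp add: lookup_add)
  qed
next
  assume *: "\<forall>m\<in>keys f. k \<le> lookup m i"
  have "mvar i ^ k dvd (Poly_Mapping.single m (lookup f m) :: ('a, 'n) mpoly)" if "m \<in> keys f" for m
  proof
    \<comment> \<open>Subtraction of exponents truncates at 0; the bound on
      \<open>lookup m i\<close> makes it exact here.\<close>
    have "m = Poly_Mapping.single i k + (m - Poly_Mapping.single i k)"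
      using * that by (intro poly_mapping_eqI) (auto simp: lookup_add lookup_minus lookup_single when_def)
    then show "Poly_Mapping.single m (lookup f m) =
        mvar i ^ k * Poly_Mapping.single (m - Poly_Mapping.single i k) (lookup f m)"
      by (simp add: mvar_power mult_single)
  qed
  then show "mvar i ^ k dvd f"
    by (subst mpoly_expand[of f]) (rule dvd_sum)
qed

section \<open>Substitutions and reduction to generators\<close>

lemma mpoly_subst_mvar_id:
  fixes f :: "('a::comm_ring_1, 'n::finite) mpoly"
  shows "mpoly_subst mvar f = f"
proof -
  have "mpoly_subst mvar f = (\<Sum>m\<in>keys f. Poly_Mapping.single m (lookup f m))"
    unfolding mpoly_subst_def
  proof (rule sum.cong)
    fix m
    have "(\<Prod>i\<in>A. mvar i ^ lookup m i) =
      (Poly_Mapping.single (\<Sum>i\<in>A. Poly_Mapping.single i (lookup m i)) 1 :: ('a, 'n) mpoly)" for A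
      by (induction A rule: infinite_finite_induct) (auto simp: mvar_power mult_single)
    moreover have "(\<Sum>i\<in>UNIV. Poly_Mapping.single i (lookup m i)) = m"
      by (rule poly_mapping_eqI) (simp add: lookup_sum lookup_single when_def)
    ultimately show "mconst (lookup f m) * (\<Prod>i\<in>UNIV. mvar i ^ lookup m i) =
        Poly_Mapping.single m (lookup f m)"
      by (simp add: mconst_def mult_single)
  qed simp
  then show ?thesis by (simp flip: mpoly_expand)
qed

text \<open>The identity substitution writes \<open>f\<close> as a finite sum of constants times
  powers of variables, and the closure properties reach every such sum.\<close>

lemma mpoly_induct [case_names const var add mult]:
  fixes f :: "('a::comm_ring_1, 'n::finite) mpoly"
  assumes const: "\<And>c. P (mconst c)" and var: "\<And>i. P (mvar i)"
    and add: "\<And>f g. P f \<Longrightarrow> P g \<Longrightarrow> P (f + g)" and mult: "\<And>f g. P f \<Longrightarrow> P g \<Longrightarrow> P (f * g)"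
  shows "P f"
proof -
  have zero: "P 0" using const[of 0] by simp
  have one: "P 1" using const[of 1] by simp
  have pow: "P (mvar i ^ k)" for i k by (induction k) (auto intro: one mult var)
  have prod: "P (\<Prod>i\<in>A. mvar i ^ lookup m i)" for A m
    by (induction A rule: infinite_finite_induct) (auto intro: one mult pow)
  have "P (\<Sum>m\<in>A. mconst (lookup f m) * (\<Prod>i\<in>UNIV. mvar i ^ lookup m i))" for A
    by (induction A rule: infinite_finite_induct) (auto intro: zero add mult const prod)
  then have "P (mpoly_subst mvar f)" by (simp only: mpoly_subst_def)
  then show "P f" by (simp only: mpoly_subst_mvar_id)
qed

lemma mpoly_subst_uminus: "mpoly_subst \<sigma> (- f) = - mpoly_subst \<sigma> f"
  using mpoly_subst_add[of \<sigma> f "- f"] by (simp add: eq_neg_iff_add_eq_0 add.commute)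

lemma mpoly_subst_diff: "mpoly_subst \<sigma> (f - g) = mpoly_subst \<sigma> f - mpoly_subst \<sigma> g"
  using mpoly_subst_add[of \<sigma> f "- g"] by (simp add: mpoly_subst_uminus)

lemma mpoly_subst_power: "mpoly_subst \<sigma> (f ^ k) = mpoly_subst \<sigma> f ^ k"
  by (induction k) (auto simp: mpoly_subst_mult)

lemma mpoly_subst_subst: "mpoly_subst \<sigma> (mpoly_subst \<tau> f) = mpoly_subst (\<lambda>i. mpoly_subst \<sigma> (\<tau> i)) f"
  by (induction f rule: mpoly_induct) (auto simp: mpoly_subst_add mpoly_subst_mult)

text \<open>Modulo \<open>d\<close> the substitution and the identity are ring homomorphisms that
  agree on generators. This serves twice: for setting a variable to 0 and for a
  transvection.\<close>

lemma dvd_mpoly_subst_diff: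
  assumes "\<And>i. d dvd \<sigma> i - mvar i"
  shows "d dvd mpoly_subst \<sigma> f - f"
proof (induction f rule: mpoly_induct)
  case (add f g)
  have "mpoly_subst \<sigma> (f + g) - (f + g) = (mpoly_subst \<sigma> f - f) + (mpoly_subst \<sigma> g - g)"
    by (simp add: mpoly_subst_add)
  with add show ?case by (metis dvd_add)
next
  case (mult f g)
  have "mpoly_subst \<sigma> (f * g) - f * g =
    (mpoly_subst \<sigma> f - f) * mpoly_subst \<sigma> g + f * (mpoly_subst \<sigma> g - g)"
    by (simp add: mpoly_subst_mult algebra_simps)
  with mult show ?case by (metis dvd_add dvd_mult dvd_mult2)
qed (use assms in auto)

subsection \<open>Homogeneous polynomials\<close>

definition mdegree :: "('n::finite \<Rightarrow>\<^sub>0 nat) \<Rightarrow> nat" where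
  "mdegree m = (\<Sum>i\<in>UNIV. lookup m i)"

definition homogeneous :: "nat \<Rightarrow> ('a::zero, 'n::finite) mpoly \<Rightarrow> bool" where
  "homogeneous d f \<longleftrightarrow> (\<forall>m\<in>keys f. mdegree m = d)"

lemma mdegree_add: "mdegree (a + b) = mdegree a + mdegree b"
  by (simp add: mdegree_def lookup_add sum.distrib)

lemma mdegree_single [simp]: "mdegree (Poly_Mapping.single i k) = k"
  by (simp add: mdegree_def lookup_single when_def)

lemma mdegree_zero [simp]: "mdegree 0 = 0"
  by (simp add: mdegree_def)

lemma mdegree_eq_0_iff: "mdegree m = 0 \<longleftrightarrow> m = 0"
  by (auto simp: mdegree_def intro: poly_mapping_eqI)

lemma homogeneous_add: "homogeneous d f \<Longrightarrow> homogeneous d g \<Longrightarrow> homogeneous d (f + g)"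
  using keys_add[of f g] by (auto simp: homogeneous_def)

lemma homogeneous_zero [simp]: "homogeneous d 0"
  by (simp add: homogeneous_def)

lemma homogeneous_sum: "(\<And>a. a \<in> A \<Longrightarrow> homogeneous d (f a)) \<Longrightarrow> homogeneous d (sum f A)"
  by (induction A rule: infinite_finite_induct) (auto intro: homogeneous_add)

lemma homogeneous_mult:
  "homogeneous d f \<Longrightarrow> homogeneous e g \<Longrightarrow> homogeneous (d + e) (f * g)"
  using keys_mult[of f g] by (force simp: homogeneous_def mdegree_add)

lemma homogeneous_mconst [simp]: "homogeneous 0 (mconst c)"
  by (auto simp: homogeneous_def mconst_def)

lemma homogeneous_one [simp]: "homogeneous 0 (1 :: ('a::comm_ring_1, 'n::finite) mpoly)"
  by (metis homogeneous_mconst mconst_one)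

lemma homogeneous_neg_one_power [simp]: "homogeneous 0 ((- 1) ^ k :: ('a::comm_ring_1, 'n::finite) mpoly)"
  by (metis homogeneous_mconst mconst_neg_one_power)

lemma homogeneous_mvar [simp]: "homogeneous 1 (mvar i)"
  by (auto simp: homogeneous_def mvar_def)

lemma homogeneous_power:
  fixes f :: "('a::comm_ring_1, 'n::finite) mpoly"
  shows "homogeneous d f \<Longrightarrow> homogeneous (k * d) (f ^ k)"
  by (induction k) (auto intro: homogeneous_mult)

lemma homogeneous_prod:
  fixes f :: "'b \<Rightarrow> ('a::comm_ring_1, 'n::finite) mpoly"
  shows "(\<And>a. a \<in> A \<Longrightarrow> homogeneous d (f a)) \<Longrightarrow> homogeneous (card A * d) (prod f A)"
  by (induction A rule: infinite_finite_induct) (auto intro: homogeneous_mult)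

lemma homogeneous_lin: "homogeneous 1 (lin v)"
proof -
  have "homogeneous (0 + 1) (mconst (v $ j) * mvar j)" for j
    by (intro homogeneous_mult homogeneous_mconst homogeneous_mvar)
  then show ?thesis by (simp add: lin_def homogeneous_sum)
qed

text \<open>Degree comparison: if \<open>h0\<close> is the constant term of \<open>h\<close>, every
  monomial of \<open>(h - h0) * P\<close> has degree above \<open>d\<close>, while those of
  \<open>Q - h0 * P\<close> have degree \<open>e\<close> or \<open>d\<close>, hence at most
  \<open>d\<close>. Both are the same polynomial, so it vanishes and \<open>h = h0\<close>.\<close>

lemma homogeneous_dvd_const:
  fixes h P Q :: "('a::idom, 'n::{finite,linorder}) mpoly"
  assumes "homogeneous d P" "homogeneous e Q" "e \<le> d" "Q = h * P" "Q \<noteq> 0"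
  obtains c where "h = mconst c" "c \<noteq> 0"
proof -
  define h0 :: "('a, 'n) mpoly" where "h0 = mconst (lookup h 0)"
  have pos: "mdegree m > 0" if "m \<in> keys (h - h0)" for m
  proof (rule ccontr)
    assume "\<not> mdegree m > 0"
    then have "m = 0" by (simp add: mdegree_eq_0_iff)
    with that show False by (simp add: in_keys_iff h0_def mconst_def lookup_minus)
  qed
  have eq: "(h - h0) * P = Q - h0 * P" using assms by (simp add: algebra_simps)
  have "keys ((h - h0) * P) = {}"
  proof (rule ccontr)
    assume "keys ((h - h0) * P) \<noteq> {}"
    then obtain m where m: "m \<in> keys ((h - h0) * P)" by blast
    then obtain a b where "m = a + b" "a \<in> keys (h - h0)" "b \<in> keys P"
      using keys_mult[of "h - h0" P] by blast
    then have "mdegree m > d" using assms(1) pos by (auto simp: homogeneous_def mdegree_add)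
    moreover have "homogeneous (0 + d) (h0 * P)"
      unfolding h0_def by (rule homogeneous_mult) (use assms in auto)
    moreover have "m \<in> keys Q \<union> keys (h0 * P)"
      using m unfolding eq by (auto simp: in_keys_iff lookup_minus)
    ultimately show False using assms(2,3) by (auto simp: homogeneous_def)
  qed
  then have "(h - h0) * P = 0" by simp
  moreover have "P \<noteq> 0" using assms by auto
  ultimately have "h = mconst (lookup h 0)" by (simp add: h0_def)
  moreover have "h \<noteq> 0" using assms by auto
  ultimately show thesis using that by (metis mconst_zero)
qed

lemma lookup_lin: "lookup (lin v) (Poly_Mapping.single k 1) = v $ k"
proof -
  have "lookup (lin v) (Poly_Mapping.single k 1) = (\<Sum>j\<in>UNIV. if j = k then v $ j else 0)"
    unfolding lin_def lookup_sum
  proof (rule sum.cong)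
    fix j
    have "mconst (v $ j) * mvar j = Poly_Mapping.single (Poly_Mapping.single j 1) (v $ j)"
      by (simp add: mconst_def mvar_def mult_single)
    moreover have "Poly_Mapping.single j (1::nat) = Poly_Mapping.single k 1 \<longleftrightarrow> j = k"
      by (metis lookup_single_eq lookup_single_not_eq zero_neq_one)
    ultimately show "lookup (mconst (v $ j) * mvar j) (Poly_Mapping.single k 1) =
        (if j = k then v $ j else 0)"
      by (simp add: lookup_single when_def)
  qed simp
  then show ?thesis by simp
qed

lemma lin_inject: "lin v = lin w \<longleftrightarrow> v = w"
proof
  assume "lin v = lin w"
  then have "v $ k = w $ k" for k using lookup_lin[of v k] lookup_lin[of w k] by simp
  then show "v = w" by (simp add: vec_eq_iff)
qed simp

lemma lin_dvd_lin_imp: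
  fixes v w :: "('a::idom, 'n::{finite,linorder}) vec"
  assumes "lin v dvd lin w" "w \<noteq> 0"
  obtains c where "c \<noteq> 0" "w = c *s v"
proof -
  obtain h where h: "lin w = h * lin v" using assms(1) by (metis dvdE mult.commute)
  have "lin w \<noteq> 0"
    using assms(2) lin_inject[of w 0] by (simp add: lin_def)
  then obtain c where "h = mconst c" "c \<noteq> 0"
    using homogeneous_dvd_const[OF homogeneous_lin homogeneous_lin _ h] by blast
  then show thesis using h that by (metis lin_scale lin_inject)
qed

subsection \<open>Prime elements\<close>

lemma prime_elem_dvd_multD': "prime_elem p \<Longrightarrow> p dvd a * b \<Longrightarrow> p dvd a \<or> p dvd b"
  unfolding prime_elem_def by blast

text \<open>Each round pulls one factor \<open>p\<close> out of \<open>b\<close> and cancels it on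
  both sides.\<close>

lemma prime_elem_power_dvd_multD:
  fixes p :: "'r::idom"
  assumes "prime_elem p" "p ^ k dvd a * b" "\<not> p dvd a"
  shows "p ^ k dvd b"
  using assms(2)
proof (induction k arbitrary: b)
  case (Suc k)
  have "p dvd a * b" using Suc.prems by (auto intro: dvd_mult_left)
  then have "p dvd b" using assms prime_elem_dvd_multD' by blast
  then obtain b' where b: "b = p * b'" by (rule dvdE)
  have "p * p ^ k dvd p * (a * b')" using Suc.prems by (simp add: b mult.left_commute)
  moreover have "p \<noteq> 0" using assms(1) by (simp add: prime_elem_def)
  ultimately have "p ^ k dvd a * b'" by simp
  then have "p ^ k dvd b'" by (rule Suc.IH)
  then show ?case by (simp add: b)
qed simp

lemma prime_elem_dvd_prodD:
  fixes p :: "'r::comm_semiring_1"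
  assumes "prime_elem p" "finite A" "p dvd (\<Prod>a\<in>A. f a ^ k)"
  shows "\<exists>a\<in>A. p dvd f a"
  using assms(2,3)
proof (induction A)
  case empty
  then show ?case using assms(1) by (simp add: prime_elem_def)
next
  case (insert a A)
  have pow: "p dvd f a" if "p dvd f a ^ j" for j
    using that
  proof (induction j)
    case 0
    then show ?case using assms(1) by (simp add: prime_elem_def)
  next
    case (Suc j)
    then show ?case using prime_elem_dvd_multD'[OF assms(1), of "f a" "f a ^ j"] by auto
  qed
  have "p dvd f a ^ k * (\<Prod>a\<in>A. f a ^ k)" using insert by simp
  then show ?case using insert.IH pow prime_elem_dvd_multD'[OF assms(1)] by blast
qed

text \<open>Write \<open>g\<close> as the product over \<open>A\<close> times \<open>h\<close>. The
  new prime \<open>f a\<close> divides no factor of that product, since otherwise \<open>a\<close>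
  would already lie in \<open>A\<close>; hence its whole power passes to \<open>h\<close>.\<close>

lemma prod_prime_power_dvd:
  fixes f :: "'b \<Rightarrow> 'r::idom"
  assumes "finite A" "\<And>a. a \<in> A \<Longrightarrow> prime_elem (f a)" "\<And>a. a \<in> A \<Longrightarrow> f a ^ k dvd g"
    and "\<And>a b. a \<in> A \<Longrightarrow> b \<in> A \<Longrightarrow> f a dvd f b \<Longrightarrow> a = b"
  shows "(\<Prod>a\<in>A. f a ^ k) dvd g"
  using assms
proof (induction A)
  case (insert a A)
  then have "(\<Prod>a\<in>A. f a ^ k) dvd g" by blast
  then obtain h where h: "g = (\<Prod>a\<in>A. f a ^ k) * h" by (rule dvdE)
  have "\<not> f a dvd (\<Prod>a\<in>A. f a ^ k)"
    using prime_elem_dvd_prodD[of "f a" A f k] insert.hyps insert.prems by blast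
  moreover have "f a ^ k dvd (\<Prod>a\<in>A. f a ^ k) * h" using insert.prems(2)[of a] h by simp
  ultimately have "f a ^ k dvd h"
    using prime_elem_power_dvd_multD insert.prems(1) by blast
  then show ?case using insert.hyps by (auto simp: h mult.commute intro: mult_dvd_mono)
qed simp

lemma mvar_ne_0 [simp]: "mvar i \<noteq> 0"
  unfolding mvar_def by (metis lookup_single_eq lookup_zero zero_neq_one)

lemma prime_elem_mvar: "prime_elem (mvar i :: ('a::idom, 'n::{finite,linorder}) mpoly)"
proof -
  let ?x = "mvar i :: ('a, 'n) mpoly"
  \<comment> \<open>Evaluation at \<open>x_i = 0\<close> is a ring homomorphism whose kernel is the
    ideal of \<open>mvar i\<close>, so primality follows from the polynomial ring being a
    domain.\<close>
  define \<sigma> where "\<sigma> = mpoly_subst (\<lambda>j. if j = i then 0 else mvar j :: ('a, 'n) mpoly)"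
  have dvd: "?x dvd f \<longleftrightarrow> \<sigma> f = 0" for f
  proof
    assume "?x dvd f"
    then show "\<sigma> f = 0" by (auto simp: \<sigma>_def mpoly_subst_mult)
  next
    assume "\<sigma> f = 0"
    moreover have "?x dvd \<sigma> f - f" unfolding \<sigma>_def by (rule dvd_mpoly_subst_diff) auto
    ultimately show "?x dvd f" by simp
  qed
  show ?thesis
    unfolding prime_elem_def dvd by (simp add: \<sigma>_def mpoly_subst_mult)
qed

section \<open>Compositions of Milnor operations\<close>

interpretation ext: module "(*\<^sub>E) :: 'r::comm_ring_1 \<Rightarrow> ('r, 'n::{finite,linorder}) exterior \<Rightarrow> _"
  by (rule module_ext_scale)

text \<open>Left multiplications by the \<open>dx i\<close> build every monomial from
  \<open>1\<close>; this form of induction matches the recursion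
  \<open>milnor_dx_mult\<close>.\<close>

lemma exterior_induct [case_names one add scale dx]:
  fixes u :: "('r::comm_ring_1, 'n::{finite,linorder}) exterior"
  assumes one: "P 1" and add: "\<And>u v. P u \<Longrightarrow> P v \<Longrightarrow> P (u + v)"
    and scale: "\<And>f u. P u \<Longrightarrow> P (f *\<^sub>E u)" and dx: "\<And>i u. P u \<Longrightarrow> P (dx i * u)"
  shows "P u"
proof -
  have mon: "P (ordered_prod dx S)" for S
  proof -
    have "finite S" by simp
    then show ?thesis
      by (induction S rule: finite_linorder_min_induct) (auto simp: ordered_prod_insert_min one dx)
  qed
  have zero: "P 0" using scale[OF one, of 0] by simp
  have "P (\<Sum>S\<in>A. ext_coeff u S *\<^sub>E ordered_prod dx S)" for A
    by (induction A rule: infinite_finite_induct) (auto intro: zero add scale mon)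
  then show ?thesis by (subst exterior_expand)
qed

text \<open>On \<open>dx i * u\<close> the composite is
  \<open>x_i^(q^k) Q_j u - x_i^(q^j) Q_k u + dx_i Q_j Q_k u\<close>: the first two terms are
  antisymmetric in \<open>j\<close> and \<open>k\<close>, the last by induction.\<close>

lemma milnor_anticomm: "milnor j (milnor k u) = - milnor k (milnor j u)"
  by (induction u rule: exterior_induct)
    (auto simp: milnor_add milnor_scale milnor_dx_mult milnor_diff)

text \<open>Anticommutation with \<open>j = k\<close> only shows that twice the square vanishes,
  hence a separate induction.\<close>

lemma milnor_sq: "milnor j (milnor j u) = 0"
  by (induction u rule: exterior_induct)
    (auto simp: milnor_add milnor_scale milnor_dx_mult milnor_diff)

lemma milnor_set_empty [simp]: "milnor_set {} u = u"
  by (simp add: milnor_set_def)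

lemma milnor_set_insert_min:
  assumes "finite J" "\<And>s. s \<in> J \<Longrightarrow> j < s"
  shows "milnor_set (insert j J) u = milnor j (milnor_set J u)"
proof -
  have "j \<notin> J" using assms by auto
  moreover have "insort j (sorted_list_of_set J) = j # sorted_list_of_set J"
    by (rule insort_is_Cons) (use assms in \<open>auto intro: less_imp_le\<close>)
  ultimately show ?thesis using assms by (simp add: milnor_set_def sorted_list_of_set_insert)
qed

lemma milnor_set_add: "milnor_set J (u + v) = milnor_set J u + milnor_set J v"
proof -
  have "foldr milnor js (u + v) = foldr milnor js u + foldr milnor js v" for js
    by (induction js) (auto simp: milnor_add)
  then show ?thesis by (simp add: milnor_set_def)
qed

lemma milnor_set_scale: "milnor_set J (f *\<^sub>E u) = f *\<^sub>E milnor_set J u"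
proof -
  have "foldr milnor js (f *\<^sub>E u) = f *\<^sub>E foldr milnor js u" for js
    by (induction js) (auto simp: milnor_scale)
  then show ?thesis by (simp add: milnor_set_def)
qed

lemma milnor_set_zero [simp]: "milnor_set J 0 = 0"
  using milnor_set_scale[of J 0 0] by simp

lemma milnor_set_diff: "milnor_set J (u - v) = milnor_set J u - milnor_set J v"
  using milnor_set_add[of J "u - v" v] by (simp add: algebra_simps)

lemma milnor_set_sum: "milnor_set J (sum f A) = (\<Sum>a\<in>A. milnor_set J (f a))"
  by (induction A rule: infinite_finite_induct) (auto simp: milnor_set_add)

text \<open>Sorting \<open>Q_j\<close> into place costs a sign for each smaller member of
  \<open>J\<close>, and a repeated index produces a square. The sign stays anonymous, but it is
  chosen before \<open>u\<close>: later arguments use only that it is \<open>1\<close> or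
  \<open>- 1\<close> and does not depend on \<open>u\<close>.\<close>

lemma milnor_milnor_set:
  fixes J :: "nat set"
  assumes "finite J"
  shows "\<exists>s\<in>{1, - 1}. \<forall>u :: ('a::{field,finite}, 'n::{finite,linorder}) poly_ext.
    milnor j (milnor_set J u) = (if j \<in> J then 0 else s *\<^sub>E milnor_set (insert j J) u)"
  using assms
proof (induction J rule: finite_linorder_min_induct)
  case empty
  have "milnor_set {j} u = milnor j u" for u :: "('a, 'n) poly_ext"
    using milnor_set_insert_min[of "{}" j u] by simp
  then show ?case by (intro bexI[of _ 1]) auto
next
  case (insert k J)
  have k: "milnor_set (insert k J) u = milnor k (milnor_set J u)" for u :: "('a, 'n) poly_ext"
    by (rule milnor_set_insert_min) (use insert in auto)
  consider "j < k" | "j = k" | "k < j" by linarith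
  then show ?case
  proof cases
    case 1
    then have "j \<notin> insert k J" using insert by auto
    moreover have "milnor_set (insert j (insert k J)) u = milnor j (milnor_set (insert k J) u)"
      for u :: "('a, 'n) poly_ext"
      by (rule milnor_set_insert_min) (use insert 1 in \<open>auto intro: less_trans\<close>)
    ultimately show ?thesis by (intro bexI[of _ 1]) auto
  next
    case 2
    then show ?thesis by (intro bexI[of _ 1]) (auto simp: k milnor_sq)
  next
    case 3
    from insert.IH obtain s where s: "s \<in> {1, - 1}"
      and eq: "\<And>u :: ('a, 'n) poly_ext.
        milnor j (milnor_set J u) = (if j \<in> J then 0 else s *\<^sub>E milnor_set (insert j J) u)"
      by blast
    have kj: "milnor_set (insert k (insert j J)) u = milnor k (milnor_set (insert j J) u)"
      for u :: "('a, 'n) poly_ext"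
      by (rule milnor_set_insert_min) (use insert 3 in auto)
    have "milnor j (milnor_set (insert k J) u) =
      (if j \<in> insert k J then 0 else (- s) *\<^sub>E milnor_set (insert j (insert k J)) u)"
      for u :: "('a, 'n) poly_ext"
      using 3 by (subst insert_commute) (simp add: k kj milnor_anticomm[of j k] eq milnor_scale)
    moreover have "- s \<in> {1, - 1}" using s by auto
    ultimately show ?thesis by blast
  qed
qed

lemma milnor_set_milnor_set:
  fixes I J :: "nat set"
  assumes "finite I" "finite J"
  shows "\<exists>s\<in>{1, - 1}. \<forall>u :: ('a::{field,finite}, 'n::{finite,linorder}) poly_ext.
    milnor_set J (milnor_set I u) = (if I \<inter> J = {} then s *\<^sub>E milnor_set (I \<union> J) u else 0)"
  using assms(2)
proof (induction J rule: finite_linorder_min_induct)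
  case empty
  show ?case by (rule bexI[of _ 1]) auto
next
  case (insert k J)
  from insert.IH obtain s where s: "s \<in> {1, - 1}"
    and eq: "\<And>u :: ('a, 'n) poly_ext.
      milnor_set J (milnor_set I u) = (if I \<inter> J = {} then s *\<^sub>E milnor_set (I \<union> J) u else 0)"
    by blast
  have "finite (I \<union> J)" using assms insert by simp
  then obtain t where t: "t \<in> {1, - 1}" and eqt: "\<And>u :: ('a, 'n) poly_ext.
      milnor k (milnor_set (I \<union> J) u) =
      (if k \<in> I \<union> J then 0 else t *\<^sub>E milnor_set (insert k (I \<union> J)) u)"
    using milnor_milnor_set by blast
  have k: "milnor_set (insert k J) u = milnor k (milnor_set J u)" for u :: "('a, 'n) poly_ext"
    by (rule milnor_set_insert_min) (use insert in auto)
  have "k \<notin> J" using insert by auto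
  then have "milnor_set (insert k J) (milnor_set I u) =
    (if I \<inter> insert k J = {} then (s * t) *\<^sub>E milnor_set (I \<union> insert k J) u else 0)"
    for u :: "('a, 'n) poly_ext"
    by (auto simp: k eq eqt milnor_scale)
  moreover have "s * t \<in> {1, - 1}" using s t by auto
  ultimately show ?case by blast
qed

section \<open>Exterior degree and the pairing of complementary index sets\<close>

definition ext_degree :: "nat \<Rightarrow> ('r::comm_ring_1, 'n::{finite,linorder}) exterior \<Rightarrow> bool" where
  "ext_degree r u \<longleftrightarrow> (\<forall>S. ext_coeff u S \<noteq> 0 \<longrightarrow> card S = r)"

lemma ext_degree_milnor:
  fixes u :: "('a::{field,finite}, 'n::{finite,linorder}) poly_ext"
  shows "ext_degree (Suc r) u \<Longrightarrow> ext_degree r (milnor j u)"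
  unfolding ext_degree_def milnor.rep_eq
proof (intro allI impI)
  fix S :: "'n set"
  assume u: "\<forall>S. ext_coeff u S \<noteq> 0 \<longrightarrow> card S = Suc r"
    and "(\<Sum>i\<in>- S. (- 1) ^ card {k \<in> S. k < i} * mvar i ^ CARD('a) ^ j * ext_coeff u (insert i S)) \<noteq> 0"
  then obtain i where "i \<in> - S" "ext_coeff u (insert i S) \<noteq> 0"
    by (metis (no_types, lifting) mult_zero_right sum.neutral)
  with u show "card S = r" by force
qed

lemma ext_degree_milnor_set:
  fixes J :: "nat set"
  assumes "finite J" "ext_degree (r + card J) u"
  shows "ext_degree r (milnor_set J u)"
  using assms
proof (induction J arbitrary: r rule: finite_linorder_min_induct)
  case (insert k J)
  have "k \<notin> J" using insert by auto
  then have "ext_degree (Suc r) (milnor_set J u)" using insert by simp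
  then show ?case using insert by (simp add: milnor_set_insert_min ext_degree_milnor)
qed simp

lemma ext_degree_dx_top: "ext_degree CARD('n) (dx_top :: ('a::{field,finite}, 'n::{finite,linorder}) poly_ext)"
  by (auto simp: ext_degree_def dx_top_def ordered_prod_dx split: if_splits)

lemma ext_degree_0D: "ext_degree 0 u \<Longrightarrow> u = ext_coeff u {} *\<^sub>E 1"
  by (rule exterior_eqI) (auto simp: ext_degree_def one_exterior.rep_eq)

text \<open>Up to sign, the Moore determinant of the matrix with entries \<open>mvar i ^ (CARD('a) ^ j)\<close>.\<close>

definition moore :: "('a::{field,finite}, 'n::{finite,linorder}) mpoly" where
  "moore = ext_coeff e_elt {}"

lemma e_elt_eq_moore: "e_elt = moore *\<^sub>E 1"
  unfolding moore_def
  by (rule ext_degree_0D) (auto simp: e_elt_def intro!: ext_degree_milnor_set ext_degree_dx_top)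

text \<open>A common index of \<open>I\<close> and \<open>J\<close> gives 0. If they are disjoint
  but do not exhaust the index set, fewer than n operations are applied to \<open>dx_top\<close>,
  and the positive exterior degree left over excludes a constant term. Only the complement remains,
  so the sign depends on \<open>I\<close> alone.\<close>

lemma milnor_set_dual:
  assumes I: "I \<subseteq> {..<CARD('n::{finite,linorder})}"
  shows "\<exists>s\<in>{1, - 1}. \<forall>J\<subseteq>{..<CARD('n)}.
    ext_coeff (milnor_set J (milnor_set I (dx_top :: ('a::{field,finite}, 'n) poly_ext))) {} =
    (if J = {..<CARD('n)} - I then s * moore else 0)"
proof -
  let ?N = "{..<CARD('n)}" and ?d = "dx_top :: ('a, 'n) poly_ext"
  have fin: "finite J" if "J \<subseteq> ?N" for J using that finite_subset by blast
  from milnor_set_milnor_set[OF fin[OF I] fin[of "?N - I"]]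
  obtain s where s: "s \<in> {1, - 1}" and "milnor_set (?N - I) (milnor_set I ?d) =
      (if I \<inter> (?N - I) = {} then s *\<^sub>E milnor_set (I \<union> (?N - I)) ?d else 0)"
    by blast
  moreover have "I \<inter> (?N - I) = {}" by auto
  ultimately have eq: "milnor_set (?N - I) (milnor_set I ?d) = s *\<^sub>E milnor_set (I \<union> (?N - I)) ?d"
    by (simp only: if_True simp_thms)
  have "ext_coeff (milnor_set J (milnor_set I ?d)) {} = (if J = ?N - I then s * moore else 0)"
    if J: "J \<subseteq> ?N" for J
  proof (cases "J = ?N - I")
    case True
    then show ?thesis using eq I by (simp add: moore_def e_elt_def Un_absorb1)
  next
    case False
    from milnor_set_milnor_set[OF fin[OF I] fin[OF J]] obtain t
      where t: "milnor_set J (milnor_set I ?d) = (if I \<inter> J = {} then t *\<^sub>E milnor_set (I \<union> J) ?d else 0)"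
      by blast
    show ?thesis
    proof (cases "I \<inter> J = {}")
      case disj: True
      have "I \<union> J \<subset> ?N" using I J disj False by auto
      then have less: "card (I \<union> J) < CARD('n)" using psubset_card_mono[of ?N "I \<union> J"] by simp
      then have "ext_degree (CARD('n) - card (I \<union> J)) (milnor_set (I \<union> J) ?d)"
        using I J by (intro ext_degree_milnor_set) (auto intro: fin ext_degree_dx_top)
      then have "ext_coeff (milnor_set (I \<union> J) ?d) {} = 0"
        using less by (auto simp: ext_degree_def)
      then show ?thesis using t disj False by simp
    qed (use t False in simp)
  qed
  with s show ?thesis by blast
qed

text \<open>The signed term of the derivation rule vanishes, so the formula holds for
  \<open>u\<close> of mixed exterior degree as well.\<close>

lemma milnor_mult_kernel: "milnor j w = 0 \<Longrightarrow> milnor j (u * w) = milnor j u * w"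
  by (induction u rule: exterior_induct)
    (auto simp: distrib_right milnor_add milnor_scale milnor_dx_mult ext_scale_mult_left
      left_diff_distrib mult.assoc)

lemma milnor_set_mult_kernel:
  fixes J :: "nat set"
  assumes "finite J" "\<And>j. j \<in> J \<Longrightarrow> milnor j w = 0"
  shows "milnor_set J (u * w) = milnor_set J u * w"
  using assms
  by (induction J rule: finite_linorder_min_induct)
    (auto simp: milnor_set_insert_min milnor_mult_kernel)

text \<open>Any monomial of positive exterior degree repeats a factor of \<open>dx_top\<close> and
  is killed by it.\<close>

lemma dx_top_mult:
  fixes w :: "('a::{field,finite}, 'n::{finite,linorder}) poly_ext"
  shows "dx_top * w = ext_coeff w {} *\<^sub>E dx_top"
proof -
  have "dx_top * w = (\<Sum>T\<in>UNIV. ext_coeff w T *\<^sub>E (dx_top * ordered_prod dx T))"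
    by (subst exterior_expand[of w]) (simp add: sum_distrib_left ext_scale_mult_right)
  also have "\<dots> = (\<Sum>T\<in>(UNIV :: 'n set set). if T = {} then ext_coeff w {} *\<^sub>E dx_top else 0)"
    by (rule sum.cong) (auto simp: dx_top_def ordered_prod_mult[of dx, OF dx_sq dx_anticomm])
  finally show ?thesis by simp
qed

text \<open>
  Apply \<open>Q\<^sub>0 \<dots> Q\<^sub>n\<^sub>-\<^sub>1\<close> to \<open>dx_top * w\<close>: by the derivation rule the result is \<open>e_elt * w\<close>, but the
  product only depends on the constant term of \<open>w\<close>.
\<close>

lemma milnor_kernel:
  fixes w :: "('a::{field,finite}, 'n::{finite,linorder}) poly_ext"
  assumes "\<And>j. j < CARD('n) \<Longrightarrow> milnor j w = 0"
  shows "moore *\<^sub>E w = (moore * ext_coeff w {}) *\<^sub>E 1"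
proof -
  have "e_elt * w = milnor_set {..<CARD('n)} (dx_top * w)"
    unfolding e_elt_def by (rule milnor_set_mult_kernel[symmetric]) (use assms in auto)
  also have "\<dots> = ext_coeff w {} *\<^sub>E e_elt"
    by (simp add: dx_top_mult milnor_set_scale e_elt_def)
  finally show ?thesis by (simp add: e_elt_eq_moore ext_scale_mult_left mult.commute)
qed

subsection \<open>The Moore determinant\<close>

definition indep_var :: "'n \<Rightarrow> ('a::zero, 'n::finite) mpoly \<Rightarrow> bool" where
  "indep_var i f \<longleftrightarrow> (\<forall>m\<in>keys f. lookup m i = 0)"

lemma indep_var_mult: "indep_var i f \<Longrightarrow> indep_var i g \<Longrightarrow> indep_var i (f * g)"
  using keys_mult[of f g] by (force simp: indep_var_def lookup_add)

lemma indep_var_sum: "(\<And>a. a \<in> A \<Longrightarrow> indep_var i (f a)) \<Longrightarrow> indep_var i (sum f A)"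
proof (induction A rule: infinite_finite_induct)
  case (insert a A)
  then show ?case using keys_add[of "f a" "sum f A"] by (auto simp: indep_var_def)
qed (auto simp: indep_var_def)

text \<open>The coefficients of \<open>dx_top\<close> have degree 0, and each
  \<open>milnor j\<close> multiplies by a variable to the power \<open>q^j\<close>.\<close>

lemma homogeneous_moore_partial:
  fixes js :: "nat list"
  shows "homogeneous (\<Sum>j\<leftarrow>js. CARD('a) ^ j)
    (ext_coeff (foldr milnor js (dx_top :: ('a::{field,finite}, 'n::{finite,linorder}) poly_ext)) S)"
proof (induction js arbitrary: S)
  case Nil
  then show ?case by (simp add: dx_top_def ordered_prod_dx)
next
  case (Cons j js)
  have "homogeneous (0 + CARD('a) ^ j * 1 + (\<Sum>j\<leftarrow>js. CARD('a) ^ j))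
     ((- 1) ^ card {k \<in> S. k < i} * mvar i ^ CARD('a) ^ j *
       ext_coeff (foldr milnor js (dx_top :: ('a, 'n) poly_ext)) (insert i S))" for i
    by (intro homogeneous_mult homogeneous_power homogeneous_mvar homogeneous_neg_one_power Cons.IH)
  then show ?case by (auto simp: milnor.rep_eq intro!: homogeneous_sum)
qed

lemma homogeneous_moore:
  "homogeneous (\<Sum>j<CARD('n). CARD('a) ^ j) (moore :: ('a::{field,finite}, 'n::{finite,linorder}) mpoly)"
proof -
  have "homogeneous (\<Sum>j\<leftarrow>[0..<CARD('n)]. CARD('a) ^ j)
    (ext_coeff (foldr milnor [0..<CARD('n)] (dx_top :: ('a, 'n) poly_ext)) {})"
    by (rule homogeneous_moore_partial)
  then show ?thesis
    by (simp add: moore_def e_elt_def milnor_set_def lessThan_atLeast0 interv_sum_list_conv_sum_set_nat)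
qed

text \<open>For a bijection \<open>r\<close> onto \<open>{0, \<dots>, n - 1}\<close>, exactly one term of the determinant contributes to
  the monomial \<open>\<Prod>i. x\<^sub>i ^ (q ^ r i)\<close>.\<close>

lemma moore_ne_0: "(moore :: ('a::{field,finite}, 'n::{finite,linorder}) mpoly) \<noteq> 0"
proof -
  let ?n = "CARD('n)" and ?q = "CARD('a)"
  obtain r :: "'n \<Rightarrow> nat" where r: "bij_betw r UNIV {..<?n}"
    using ex_bij_betw_finite_nat[of "UNIV :: 'n set"] by (auto simp: atLeast0LessThan)
  \<comment> \<open>\<open>v m\<close> is \<open>dx_top\<close> after the operations with index at
    least \<open>m\<close>; \<open>M m\<close> is the corresponding part of the chosen
    monomial.\<close>
  define v where "v m = foldr milnor [m..<?n] (dx_top :: ('a, 'n) poly_ext)" for m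
  define M where "M m = (\<Sum>i\<in>{i. m \<le> r i}. Poly_Mapping.single i (?q ^ r i))" for m
  have rn: "r i < ?n" for i using r by (auto simp: bij_betw_def)
  have v_Suc: "v m = milnor m (v (Suc m))" if "m < ?n" for m
    using that by (simp add: v_def upt_conv_Cons)
  have v_n: "v ?n = dx_top" by (simp add: v_def)
  have q: "?q > 1"
    using card_mono[of "UNIV :: 'a set" "{0, 1}"] by simp
  \<comment> \<open>A coefficient at \<open>S\<close> has been multiplied only by variables whose
    \<open>dx\<close> was removed, that is, variables outside \<open>S\<close>.\<close>
  have indep: "indep_var i (ext_coeff (v m) S)" if "m \<le> ?n" "i \<in> S" for m i S
    using that
  proof (induction m arbitrary: S rule: inc_induct)
    case base
    then show ?case by (simp add: v_n dx_top_def ordered_prod_dx indep_var_def)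
  next
    case (step m)
    show ?case
      unfolding v_Suc[OF step.hyps(2)] milnor.rep_eq
    proof (intro indep_var_sum indep_var_mult)
      fix k assume "k \<in> - S"
      then have "k \<noteq> i" using step.prems by auto
      then show "indep_var i (mvar k ^ ?q ^ m :: ('a, 'n) mpoly)"
        by (simp add: mvar_power indep_var_def lookup_single)
      show "indep_var i ((- 1) ^ card {k' \<in> S. k' < k} :: ('a, 'n) mpoly)"
        by (simp add: indep_var_def mconst_def flip: mconst_neg_one_power)
      show "indep_var i (ext_coeff (v (Suc m)) (insert k S))"
        using step.IH step.prems by auto
    qed
  qed
  \<comment> \<open>Downward induction on \<open>m\<close>, from \<open>dx_top\<close> and the empty
    monomial to the constant term of \<open>e_elt\<close>.\<close>
  have "lookup (ext_coeff (v m) {i. r i < m}) (M m) \<in> {1, - 1}" if "m \<le> ?n" for m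
    using that
  proof (induction m rule: inc_induct)
    case base
    have "{i. r i < ?n} = UNIV" using rn by auto
    moreover have "{i. ?n \<le> r i} = {}" using rn by (auto simp: not_le)
    ultimately show ?case by (simp add: v_n M_def dx_top_def ordered_prod_dx)
  next
    case (step m)
    let ?S = "{i. r i < m}"
    obtain k where k: "r k = m" using r step.hyps by (metis bij_betw_imp_surj_on imageE lessThan_iff)
    have inj: "r i = r j \<longleftrightarrow> i = j" for i j using r by (auto simp: bij_betw_def inj_on_def)
    have S: "insert k ?S = {i. r i < Suc m}" using k inj by (auto simp: less_Suc_eq)
    have M: "M m = Poly_Mapping.single k (?q ^ m) + M (Suc m)"
    proof -
      have "{i. m \<le> r i} = insert k {i. Suc m \<le> r i}"
        using k inj by (auto simp: Suc_le_eq order.order_iff_strict)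
      then show ?thesis using k by (simp add: M_def)
    qed
    have sgn: "(- 1) ^ c * f = Poly_Mapping.single 0 ((- 1) ^ c) * f" for c and f :: "('a, 'n) mpoly"
      by (simp flip: mconst_neg_one_power mconst_def)
    have lookup_M: "lookup (M m) i = (if m \<le> r i then ?q ^ r i else 0)" for i
      by (simp add: M_def lookup_sum lookup_single when_def)
    have "lookup (ext_coeff (v m) ?S) (M m) =
      (\<Sum>i\<in>- ?S. if i = k then (- 1) ^ card {j \<in> ?S. j < k} *
        lookup (ext_coeff (v (Suc m)) {i. r i < Suc m}) (M (Suc m)) else 0)"
      unfolding v_Suc[OF step.hyps(2)] milnor.rep_eq lookup_sum
    proof (rule sum.cong)
      fix i assume i: "i \<in> - ?S"
      let ?f = "ext_coeff (v (Suc m)) (insert i ?S)"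
      have eq: "(- 1) ^ card {j \<in> ?S. j < i} * mvar i ^ ?q ^ m * ?f =
        Poly_Mapping.single (Poly_Mapping.single i (?q ^ m)) ((- 1) ^ card {j \<in> ?S. j < i}) * ?f"
        by (subst sgn) (simp add: mvar_power mult_single)
      show "lookup ((- 1) ^ card {j \<in> ?S. j < i} * mvar i ^ ?q ^ m * ?f) (M m) =
        (if i = k then (- 1) ^ card {j \<in> ?S. j < k} *
        lookup (ext_coeff (v (Suc m)) {i. r i < Suc m}) (M (Suc m)) else 0)"
      proof (cases "i = k")
        case True
        then show ?thesis unfolding eq by (simp only: M lookup_single_mult_add S if_True simp_thms)
      next
        case False
        then have "r i \<noteq> m" using inj k by auto
        moreover have "\<not> r i < m" using i by simp
        ultimately have "m < r i" by linarith
        then have less: "?q ^ m < ?q ^ r i" using q by simp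
        \<comment> \<open>By \<open>indep\<close> the summand of \<open>i\<close> contains
          \<open>x_i\<close> exactly to the power \<open>q^m\<close>, whereas \<open>M m\<close>
          asks for the larger power \<open>q^(r i)\<close>.\<close>
        have "Poly_Mapping.single i (?q ^ m) + a \<noteq> M m" if "a \<in> keys ?f" for a
        proof
          assume "Poly_Mapping.single i (?q ^ m) + a = M m"
          then have "lookup (Poly_Mapping.single i (?q ^ m) + a) i = lookup (M m) i" by simp
          then have "?q ^ m + lookup a i = ?q ^ r i"
            using \<open>m < r i\<close> by (simp add: lookup_add lookup_M)
          moreover have "lookup a i = 0"
            using indep[of "Suc m" i "insert i ?S"] step.hyps that by (auto simp: indep_var_def)
          ultimately show False using less by simp
        qed
        then have "lookup (Poly_Mapping.single (Poly_Mapping.single i (?q ^ m))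
            ((- 1) ^ card {j \<in> ?S. j < i}) * ?f) (M m) = 0"
          unfolding lookup_single_mult by (intro sum.neutral) (auto simp: when_def)
        then show ?thesis unfolding eq using False by simp
      qed
    qed simp
    also have "\<dots> = (- 1) ^ card {j \<in> ?S. j < k} *
        lookup (ext_coeff (v (Suc m)) {i. r i < Suc m}) (M (Suc m))"
      using k by (subst sum.delta) auto
    finally show ?case
      using step.IH by (cases "even (card {j \<in> ?S. j < k})") auto
  qed
  from this[of 0] have "ext_coeff (v 0) {} \<noteq> 0" by auto
  moreover have "v 0 = e_elt"
    by (simp add: v_def e_elt_def milnor_set_def lessThan_atLeast0)
  ultimately show ?thesis by (simp add: moore_def)
qed

subsection \<open>Expansion in the elements \<open>milnor_set I dx_top\<close>\<close>

text \<open>Descend from large \<open>J\<close>: all \<open>Q_j\<close> kill \<open>Q_J w\<close>,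
  by induction if \<open>j\<close> is new and by repetition otherwise. Then
  \<open>milnor_kernel\<close> reduces \<open>moore\<close> times \<open>Q_J w\<close> to its
  constant term, which is 0. The case of empty \<open>J\<close> is the claim.\<close>

lemma milnor_set_nondegenerate:
  fixes w :: "('a::{field,finite}, 'n::{finite,linorder}) poly_ext"
  assumes "\<And>J. J \<subseteq> {..<CARD('n)} \<Longrightarrow> ext_coeff (milnor_set J w) {} = 0"
  shows "w = 0"
proof -
  let ?N = "{..<CARD('n)}"
  have "milnor_set J w = 0" if "J \<subseteq> ?N" for J
    using that
  proof (induction "card (?N - J)" arbitrary: J rule: less_induct)
    case less
    have fin: "finite J" using less.prems finite_subset by blast
    have "milnor j (milnor_set J w) = 0" if j: "j < CARD('n)" for j
    proof (cases "j \<in> J")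
      case False
      have "card (?N - insert j J) < card (?N - J)"
        by (rule psubset_card_mono) (use j False in auto)
      then have "milnor_set (insert j J) w = 0" using less j by auto
      then show ?thesis using milnor_milnor_set[OF fin, of j] by (metis ext.scale_zero_right)
    qed (use milnor_milnor_set[OF fin, of j] in \<open>meson\<close>)
    then have "moore *\<^sub>E milnor_set J w = (moore * ext_coeff (milnor_set J w) {}) *\<^sub>E 1"
      by (rule milnor_kernel)
    then have "moore *\<^sub>E milnor_set J w = 0" using assms less.prems by simp
    then have "moore * ext_coeff (milnor_set J w) S = 0" for S
      by (metis ext_coeff_simps(1,5))
    then show ?case using moore_ne_0 by (intro exterior_eqI) auto
  qed
  from this[of "{}"] show ?thesis by simp
qed

text \<open>Applying \<open>Q_J\<close> for the complement \<open>J\<close> of \<open>I\<close> and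
  taking the constant term isolates \<open>c I\<close> up to a factor \<open>moore\<close> and a
  sign.\<close>

lemma milnor_set_dx_top_independent:
  assumes "(\<Sum>I\<in>Pow {..<CARD('n)}.
      c I *\<^sub>E milnor_set I (dx_top :: ('a::{field,finite}, 'n::{finite,linorder}) poly_ext)) = 0"
    and I: "I \<subseteq> {..<CARD('n)}"
  shows "c I = 0"
proof -
  let ?N = "{..<CARD('n)}"
  obtain s :: "nat set \<Rightarrow> ('a, 'n) mpoly" where s: "\<And>I. I \<subseteq> ?N \<Longrightarrow> s I \<in> {1, - 1}"
    and eq: "\<And>I J. I \<subseteq> ?N \<Longrightarrow> J \<subseteq> ?N \<Longrightarrow>
      ext_coeff (milnor_set J (milnor_set I (dx_top :: ('a, 'n) poly_ext))) {} =
      (if J = ?N - I then s I * moore else 0)"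
    using milnor_set_dual[where 'a = 'a and 'n = 'n] by metis
  have "0 = ext_coeff (milnor_set (?N - I) (\<Sum>I\<in>Pow ?N. c I *\<^sub>E milnor_set I dx_top)) {}"
    using assms(1) by simp
  also have "\<dots> = (\<Sum>I'\<in>Pow ?N. if I' = I then c I * (s I * moore) else 0)"
    unfolding milnor_set_sum milnor_set_scale ext_coeff_sum ext_coeff_simps
  proof (rule sum.cong)
    fix I' assume I': "I' \<in> Pow ?N"
    have "?N - I = ?N - I' \<longleftrightarrow> I' = I" using I I' by auto
    then show "c I' * ext_coeff (milnor_set (?N - I) (milnor_set I' (dx_top :: ('a, 'n) poly_ext))) {} =
      (if I' = I then c I * (s I * moore) else 0)"
      using I' by (subst eq) auto
  qed simp
  also have "\<dots> = c I * (s I * moore)" using I by simp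
  finally show ?thesis using s[OF I] moore_ne_0[where 'a = 'a and 'n = 'n] by auto
qed

text \<open>By duality both sides have the same constant term after every \<open>Q_J\<close>, and by
  nondegeneracy these constant terms determine an element.\<close>

lemma milnor_set_dx_top_expansion:
  "\<exists>s. (\<forall>I\<subseteq>{..<CARD('n)}. s I \<in> {1, - 1}) \<and>
    (\<forall>u :: ('a::{field,finite}, 'n::{finite,linorder}) poly_ext.
      moore *\<^sub>E u = (\<Sum>I\<in>Pow {..<CARD('n)}.
        (s I * ext_coeff (milnor_set ({..<CARD('n)} - I) u) {}) *\<^sub>E milnor_set I dx_top))"
proof -
  let ?N = "{..<CARD('n)}"
  obtain s :: "nat set \<Rightarrow> ('a, 'n) mpoly" where s: "\<And>I. I \<subseteq> ?N \<Longrightarrow> s I \<in> {1, - 1}"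
    and eq: "\<And>I J. I \<subseteq> ?N \<Longrightarrow> J \<subseteq> ?N \<Longrightarrow>
      ext_coeff (milnor_set J (milnor_set I (dx_top :: ('a, 'n) poly_ext))) {} =
      (if J = ?N - I then s I * moore else 0)"
    using milnor_set_dual[where 'a = 'a and 'n = 'n] by metis
  have "moore *\<^sub>E u = (\<Sum>I\<in>Pow ?N.
      (s I * ext_coeff (milnor_set (?N - I) u) {}) *\<^sub>E milnor_set I dx_top)" (is "_ = ?r") for u
  proof -
    have "moore *\<^sub>E u - ?r = 0"
    proof (rule milnor_set_nondegenerate)
      fix J assume J: "J \<subseteq> ?N"
      define f where "f = ext_coeff (milnor_set J u) {}"
      have "ext_coeff (milnor_set J ?r) {} =
        (\<Sum>I\<in>Pow ?N. if I = ?N - J then moore * f else 0)"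
        unfolding milnor_set_sum milnor_set_scale ext_coeff_sum ext_coeff_simps
      proof (rule sum.cong)
        fix I assume I: "I \<in> Pow ?N"
        have "J = ?N - I \<longleftrightarrow> I = ?N - J" using I J by auto
        moreover have "?N - (?N - J) = J" using J by auto
        \<comment> \<open>The sign occurs once in the coefficient and once in the duality, so it
          cancels.\<close>
        moreover have "s I * f * (s I * moore) = moore * f"
          using s[of I] I by (auto simp: mult.commute)
        ultimately show "s I * ext_coeff (milnor_set (?N - I) u) {} *
            ext_coeff (milnor_set J (milnor_set I (dx_top :: ('a, 'n) poly_ext))) {} =
            (if I = ?N - J then moore * f else 0)"
          using I J by (cases "I = ?N - J") (simp_all add: eq f_def)
      qed simp
      also have "\<dots> = moore * f" by simp
      finally show "ext_coeff (milnor_set J (moore *\<^sub>E u - ?r)) {} = 0"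
        by (simp add: milnor_set_diff milnor_set_scale f_def)
    qed
    then show ?thesis by simp
  qed
  with s show ?thesis by blast
qed

section \<open>The general linear group\<close>

lemma matrix_inv_eqI:
  fixes A B :: "'a::field^'n^'n"
  assumes "A ** B = mat 1"
  shows "matrix_inv A = B"
proof -
  have BA: "B ** A = mat 1" using assms by (simp add: matrix_left_right_inverse)
  have "A ** matrix_inv A = mat 1 \<and> matrix_inv A ** A = mat 1"
    unfolding matrix_inv_def by (rule someI[of _ B]) (use assms BA in simp)
  then have "matrix_inv A = matrix_inv A ** (A ** B)" using assms by simp
  also have "\<dots> = B"
    using \<open>_ \<and> _\<close> by (simp add: matrix_mul_assoc)
  finally show ?thesis .
qed

lemma GL_inverse:
  assumes "g \<in> GL"
  shows "g ** matrix_inv g = mat 1" "matrix_inv g ** g = mat 1" "matrix_inv (matrix_inv g) = g"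
proof -
  from assms obtain B where "g ** B = mat 1" by (auto simp: GL_def invertible_def)
  moreover from this have "B ** g = mat 1" by (simp add: matrix_left_right_inverse)
  ultimately show "g ** matrix_inv g = mat 1" "matrix_inv g ** g = mat 1" "matrix_inv (matrix_inv g) = g"
    by (simp_all add: matrix_inv_eqI)
qed

lemma poly_act_eq_subst: "poly_act g = mpoly_subst (\<lambda>i. lin (matrix_inv g $ i))"
  by (simp add: poly_act_def lin_def)

lemma lin_matrix_mult: "(\<Sum>j\<in>UNIV. mconst (A $ i $ j) * lin (B $ j)) = lin ((A ** B) $ i)"
  unfolding lin_def matrix_matrix_mult_def
  by (simp add: mconst_sum mconst_mult sum_distrib_left sum_distrib_right mult.assoc)
    (rule sum.swap)

lemma poly_act_inverse:
  assumes "g \<in> GL"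
  shows "poly_act (matrix_inv g) (poly_act g f) = f" "poly_act g (poly_act (matrix_inv g) f) = f"
proof -
  have mat: "mat 1 $ i = axis i 1" for i :: 'b
    by (simp add: mat_def axis_def vec_eq_iff)
  have "mpoly_subst (\<lambda>j. lin (B $ j)) (lin (A $ i)) = lin ((A ** B) $ i)" for A B :: "'a^'b^'b" and i
    by (subst lin_def) (simp add: mpoly_subst_sum mpoly_subst_mult lin_matrix_mult)
  then show "poly_act (matrix_inv g) (poly_act g f) = f" "poly_act g (poly_act (matrix_inv g) f) = f"
    using GL_inverse[OF assms]
    by (simp_all add: poly_act_eq_subst mpoly_subst_subst mat mpoly_subst_mvar_id)
qed

lemma poly_act_simps [simp]:
  "poly_act g 0 = 0" "poly_act g 1 = 1" "poly_act g (mconst c) = mconst c"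
  "poly_act g (f + h) = poly_act g f + poly_act g h"
  "poly_act g (- f) = - poly_act g f"
  "poly_act g (f - h) = poly_act g f - poly_act g h"
  "poly_act g (f ^ k) = poly_act g f ^ k"
  by (simp_all add: poly_act_def mpoly_subst_add mpoly_subst_uminus mpoly_subst_diff mpoly_subst_power)

text \<open>One shape for all group elements that are needed: transvections, diagonal matrices
  scaling one variable, and substitutions sending a variable to a given linear form.\<close>

definition row_matrix :: "'n \<Rightarrow> 'a::field^'n \<Rightarrow> 'a^'n^'n" where
  "row_matrix j w = (\<chi> i. if i = j then w else axis i 1)"

lemma row_matrix_mult:
  fixes w :: "'a::field^'n"
  assumes "w $ j \<noteq> 0"
  shows "row_matrix j w ** row_matrix j (\<chi> k. if k = j then 1 / w $ j else - w $ k / w $ j) = mat 1"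
proof -
  let ?w = "\<chi> k. if k = j then 1 / w $ j else - w $ k / w $ j"
  have "(row_matrix j w ** row_matrix j ?w) $ i $ k = mat 1 $ i $ k" for i k
  proof (cases "i = j")
    case False
    then have "(row_matrix j w ** row_matrix j ?w) $ i $ k =
      (\<Sum>l\<in>UNIV. if l = i then row_matrix j ?w $ i $ k else 0)"
      unfolding matrix_matrix_mult_def vec_lambda_beta
      by (intro sum.cong refl) (auto simp: row_matrix_def axis_def)
    then show ?thesis using False by (simp add: row_matrix_def axis_def mat_def)
  next
    case True
    then have "(row_matrix j w ** row_matrix j ?w) $ i $ k =
      (\<Sum>l\<in>UNIV. (if l = j then w $ j * ?w $ k else 0) + (if l = k then (if k = j then 0 else w $ k) else 0))"
      unfolding matrix_matrix_mult_def vec_lambda_beta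
      by (intro sum.cong refl) (auto simp: row_matrix_def axis_def)
    then show ?thesis using True assms by (auto simp: sum.distrib mat_def)
  qed
  then show ?thesis by (simp add: vec_eq_iff)
qed

text \<open>The action is defined through \<open>matrix_inv g\<close>, so it is the inverse that has
  to be prescribed.\<close>

lemma obtain_row_matrix:
  fixes w :: "'a::field^'n"
  assumes "w $ j \<noteq> 0"
  obtains g where "g \<in> GL" "matrix_inv g = row_matrix j w"
proof -
  let ?B = "row_matrix j (\<chi> k. if k = j then 1 / w $ j else - w $ k / w $ j)"
  have "row_matrix j w ** ?B = mat 1" using assms by (rule row_matrix_mult)
  then have "?B ** row_matrix j w = mat 1" by (simp add: matrix_left_right_inverse)
  then have "?B \<in> GL" "matrix_inv ?B = row_matrix j w"
    using \<open>row_matrix j w ** ?B = mat 1\<close>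
    by (auto simp: GL_def invertible_def intro: matrix_inv_eqI)
  then show thesis by (rule that)
qed

section \<open>Compatibility of the action with scalars and constant terms\<close>

lemma ext_act_scale:
  fixes g :: "('a::field, 'n::{finite,linorder}) sq_matrix"
  shows "ext_act g (f *\<^sub>E u) = poly_act g f *\<^sub>E ext_act g u"
  using ext_act_mult[of g "f *\<^sub>E 1" u] by (simp add: ext_scale_mult_left ext_act_poly)

lemma ext_act_one [simp]: "ext_act g 1 = 1"
  using ext_act_poly[of g 1] by simp

lemma ext_act_zero [simp]: "ext_act g 0 = 0"
  using ext_act_scale[of g 0 0] by simp

lemma ext_act_diff: "ext_act g (u - v) = ext_act g u - ext_act g v"
  using ext_act_add[of g "u - v" v] by (simp add: algebra_simps)

lemma ext_coeff_ext_act_empty: "ext_coeff (ext_act g u) {} = poly_act g (ext_coeff u {})"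
proof (induction u rule: exterior_induct)
  case one
  then show ?case by (simp add: one_exterior.rep_eq)
next
  case (dx i u)
  show ?case
    by (simp add: ext_act_mult ext_act_dx dx_act_def sum_distrib_right ext_scale_mult_left ext_coeff_dx_mult)
qed (simp_all add: ext_act_add ext_act_scale poly_act_mult)

subsection \<open>Frobenius\<close>

lemma finite_field_power_card_minus_1:
  fixes x :: "'a::{field,finite}"
  assumes "x \<noteq> 0"
  shows "x ^ (CARD('a) - 1) = 1"
proof -
  \<comment> \<open>Multiplication by \<open>x\<close> permutes the nonzero elements, so their
    product absorbs the factor \<open>x ^ (CARD('a) - 1)\<close>.\<close>
  have "(\<Prod>y\<in>UNIV-{0}. x * y) = (\<Prod>y\<in>UNIV-{0}. y)"
    by (rule prod.reindex_bij_witness[of _ "\<lambda>y. y / x" "\<lambda>y. x * y"]) (use assms in auto)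
  then have "x ^ (CARD('a) - 1) * \<Prod>(UNIV-{0 :: 'a}) = \<Prod>(UNIV-{0})"
    by (simp add: prod.distrib)
  moreover have "\<Prod>(UNIV-{0 :: 'a}) \<noteq> 0" by simp
  ultimately show ?thesis by simp
qed

lemma card_field_gt_1: "CARD('a::{field,finite}) > 1"
  using card_mono[of "UNIV :: 'a set" "{0, 1}"] by simp

lemma finite_field_power_card_power:
  fixes x :: "'a::{field,finite}"
  shows "x ^ (CARD('a) ^ m) = x"
proof (induction m)
  case (Suc m)
  have "x ^ CARD('a) = x"
  proof (cases "x = 0")
    case False
    have "x ^ CARD('a) = x * x ^ (CARD('a) - 1)"
      using card_field_gt_1[where 'a = 'a] by (metis One_nat_def Suc_pred less_trans power_Suc zero_less_one)
    then show ?thesis using False finite_field_power_card_minus_1 by simp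
  qed (use card_field_gt_1[where 'a = 'a] in simp)
  then show ?case using Suc by (simp add: power_mult)
qed simp

lemma lin_power_card:
  fixes v :: "('a::{field,finite}, 'n::{finite,linorder}) vec"
  assumes "prime p" "CARD('a) = p ^ k"
  shows "lin v ^ (CARD('a) ^ m) = (\<Sum>j\<in>UNIV. mconst (v $ j) * mvar j ^ (CARD('a) ^ m))"
proof -
  \<comment> \<open>Translation by 1 permutes the field, so summing all elements shows that q, and
    hence \<open>p\<close>, is 0 in it. This identifies the characteristic needed for the additivity
    of \<open>p\<close>-th powers.\<close>
  have "(\<Sum>x\<in>UNIV. x + 1 :: 'a) = (\<Sum>x\<in>UNIV. x)"
    by (rule sum.reindex_bij_witness[of _ "\<lambda>x. x - 1" "\<lambda>x. x + 1"]) auto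
  then have "of_nat CARD('a) = (0 :: 'a)" by (simp add: sum.distrib)
  then have "of_nat p = (0 :: 'a)" by (simp add: assms(2))
  moreover have "of_nat i = (mconst (of_nat i) :: ('a, 'n) mpoly)" for i
    by (induction i) (auto simp: mconst_add)
  ultimately have "of_nat p = (0 :: ('a, 'n) mpoly)" by simp
  then have "CHAR(('a, 'n) mpoly) dvd p" by (simp add: of_nat_eq_0_iff_char_dvd)
  then have CHAR: "CHAR(('a, 'n) mpoly) = p"
    using assms(1) CHAR_not_1'[where 'a = "('a, 'n) mpoly"] by (auto simp: prime_nat_iff)
  have "lin v ^ (CARD('a) ^ m) = (\<Sum>j\<in>UNIV. (mconst (v $ j) * mvar j) ^ (CARD('a) ^ m))"
    unfolding lin_def
    by (rule freshmans_dream_sum'[where n = "k * m"]) (use assms CHAR in \<open>auto simp: power_mult\<close>)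
  also have "\<dots> = (\<Sum>j\<in>UNIV. mconst (v $ j) * mvar j ^ (CARD('a) ^ m))"
    by (simp add: power_mult_distrib finite_field_power_card_power flip: mconst_power)
  finally show ?thesis .
qed

text \<open>Only \<open>dx i\<close> matters: \<open>Q_j\<close> sends its image to a linear
  combination of the \<open>x_l^(q^j)\<close>, which is the image of \<open>x_i^(q^j)\<close>
  because \<open>lin_power_card\<close> makes this power additive and fixes the
  coefficients.\<close>

lemma milnor_ext_act:
  fixes u :: "('a::{field,finite}, 'n::{finite,linorder}) poly_ext"
  assumes "prime p" "CARD('a) = p ^ k"
  shows "milnor j (ext_act g u) = ext_act g (milnor j u)"
proof (induction u rule: exterior_induct)
  case (dx i u)
  let ?y = "\<lambda>i. mvar i ^ (CARD('a) ^ j) :: ('a, 'n) mpoly"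
  have "milnor j (dx_act g i * v) = poly_act g (?y i) *\<^sub>E v - dx_act g i * milnor j v"
    for v :: "('a, 'n) poly_ext"
  proof -
    have "poly_act g (?y i) = (\<Sum>k\<in>UNIV. mconst (matrix_inv g $ i $ k) * ?y k)"
      by (simp add: poly_act_eq_subst mpoly_subst_power lin_power_card[OF assms])
    then show ?thesis
      by (simp add: dx_act_def sum_distrib_right ext_scale_mult_left milnor_sum milnor_scale
          milnor_dx_mult ext.scale_right_diff_distrib sum_subtractf ext.scale_sum_left)
  qed
  then show ?case
    using dx by (simp add: ext_act_mult ext_act_dx milnor_dx_mult ext_act_diff ext_act_scale)
qed (simp_all add: ext_act_add milnor_add ext_act_scale milnor_scale)

lemma milnor_set_ext_act:
  fixes u :: "('a::{field,finite}, 'n::{finite,linorder}) poly_ext"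
  assumes "prime p" "CARD('a) = p ^ k"
  shows "milnor_set J (ext_act g u) = ext_act g (milnor_set J u)"
proof -
  have "foldr milnor js (ext_act g u) = ext_act g (foldr milnor js u)" for js
    by (induction js) (auto simp: milnor_ext_act[OF assms])
  then show ?thesis by (simp add: milnor_set_def)
qed

text \<open>A product of r images of generators has constant coefficients, supported on sets of size
  r, and in top degree there is one such set. The constant \<open>c\<close> is the determinant of
  \<open>matrix_inv g\<close>.\<close>

lemma ext_act_dx_top:
  fixes g :: "('a::{field,finite}, 'n::{finite,linorder}) sq_matrix"
  obtains c where "ext_act g dx_top = mconst c *\<^sub>E dx_top"
proof -
  have "\<exists>h. \<forall>T. ext_coeff (ordered_prod (dx_act g) S) T = mconst (h T) \<and> (h T \<noteq> 0 \<longrightarrow> card T = card S)" for S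
  proof -
    have "finite S" by simp
    then show ?thesis
    proof (induction S rule: finite_linorder_min_induct)
      case empty
      show ?case
        by (rule exI[of _ "\<lambda>T. if T = {} then 1 else 0"]) (simp add: one_exterior.rep_eq)
    next
      case (insert i S)
      then obtain h where h: "\<And>T. ext_coeff (ordered_prod (dx_act g) S) T = mconst (h T)"
        "\<And>T. h T \<noteq> 0 \<Longrightarrow> card T = card S" by blast
      have i: "i \<notin> S" using insert by auto
      \<comment> \<open>Expansion of a minor along its first row.\<close>
      define h' where "h' T = (\<Sum>k\<in>T. matrix_inv g $ i $ k * ((- 1) ^ card {l \<in> T. l < k} * h (T - {k})))" for T
      have "ext_coeff (ordered_prod (dx_act g) (insert i S)) T = mconst (h' T)" for T
      proof -
        have "ordered_prod (dx_act g) (insert i S) = dx_act g i * ordered_prod (dx_act g) S"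
          by (rule ordered_prod_insert_min) (use insert in auto)
        then have "ext_coeff (ordered_prod (dx_act g) (insert i S)) T = (\<Sum>k\<in>UNIV. if k \<in> T then
          mconst (matrix_inv g $ i $ k) * ((- 1) ^ card {l \<in> T. l < k} * mconst (h (T - {k}))) else 0)"
          by (simp add: dx_act_def sum_distrib_right ext_scale_mult_left ext_coeff_dx_mult h
              if_distrib cong: if_cong)
        also have "\<dots> = mconst (h' T)"
          by (simp add: h'_def mconst_sum mconst_mult mconst_neg_one_power sum.If_cases)
        finally show ?thesis .
      qed
      moreover have "card T = card (insert i S)" if "h' T \<noteq> 0" for T
      proof -
        have "\<exists>k\<in>T. h (T - {k}) \<noteq> 0"
        proof (rule ccontr)
          assume "\<not> ?thesis"
          then have "h' T = 0" unfolding h'_def by (intro sum.neutral) auto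
          with that show False by simp
        qed
        then obtain k where "k \<in> T" "h (T - {k}) \<noteq> 0" by blast
        then have "card (T - {k}) = card S" using h(2) by blast
        moreover have "card T = Suc (card (T - {k}))" using \<open>k \<in> T\<close> by (intro card.remove) auto
        ultimately show ?thesis using i by simp
      qed
      ultimately show ?case by blast
    qed
  qed
  then obtain h where h: "\<And>T. ext_coeff (ordered_prod (dx_act g) UNIV) T = mconst (h T)"
    "\<And>T. h T \<noteq> 0 \<Longrightarrow> card T = CARD('n)" by blast
  have "ext_act g dx_top = ordered_prod (dx_act g) UNIV"
    using ext_act_monomial[of g 1 UNIV] by (simp add: dx_top_def)
  also have "\<dots> = mconst (h UNIV) *\<^sub>E dx_top"
  proof (rule exterior_eqI)
    fix T
    show "ext_coeff (ordered_prod (dx_act g) UNIV) T = ext_coeff (mconst (h UNIV) *\<^sub>E dx_top) T"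
    proof (cases "T = UNIV")
      case False
      then have "h T = 0" using h(2)[of T] card_subset_eq[of UNIV T] by auto
      then show ?thesis using False by (simp add: h(1) dx_top_def ordered_prod_dx)
    qed (simp add: h(1) dx_top_def ordered_prod_dx)
  qed
  finally show thesis by (rule that)
qed

text \<open>The Milnor operations commute with \<open>g\<close>, so every
  \<open>milnor_set I dx_top\<close>, and with it \<open>moore\<close>, inherits the character of
  \<open>dx_top\<close>. Were \<open>c\<close> zero, the invertible action would kill
  \<open>moore\<close>.\<close>

lemma ext_act_milnor_set_dx_top:
  fixes g :: "('a::{field,finite}, 'n::{finite,linorder}) sq_matrix"
  assumes "prime p" "CARD('a) = p ^ k" "g \<in> GL"
  shows "\<exists>c. c \<noteq> 0 \<and> poly_act g moore = mconst c * moore \<and>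
    (\<forall>I. ext_act g (milnor_set I dx_top) = mconst c *\<^sub>E milnor_set I dx_top)"
proof -
  obtain c where c: "ext_act g dx_top = mconst c *\<^sub>E dx_top" by (rule ext_act_dx_top)
  have Q: "ext_act g (milnor_set I dx_top) = mconst c *\<^sub>E milnor_set I dx_top" for I
    by (simp add: c milnor_set_scale flip: milnor_set_ext_act[OF assms(1,2)])
  have moore: "poly_act g moore = mconst c * moore"
    using Q[of "{..<CARD('n)}"]
    by (simp add: moore_def e_elt_def flip: ext_coeff_ext_act_empty)
  have "c \<noteq> 0"
  proof
    assume "c = 0"
    then have "poly_act (matrix_inv g) (poly_act g (moore :: ('a, 'n) mpoly)) = 0" by (simp add: moore)
    then show False using moore_ne_0[where 'a = 'a and 'n = 'n] by (simp add: poly_act_inverse assms)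
  qed
  with Q moore show ?thesis by blast
qed

section \<open>Divisibility of invariants\<close>

lemma poly_invariants_coeff_milnor_set:
  fixes u :: "('a::{field,finite}, 'n::{finite,linorder}) poly_ext"
  assumes "prime p" "CARD('a) = p ^ k" "u \<in> ext_invariants"
  shows "ext_coeff (milnor_set J u) {} \<in> poly_invariants"
  using assms(3)
  by (simp add: poly_invariants_def ext_invariants_def
      flip: ext_coeff_ext_act_empty milnor_set_ext_act[OF assms(1,2)])

text \<open>
  Compare the coefficients of \<open>u\<close> and its image under the transvection \<open>x\<^sub>j \<mapsto> x\<^sub>j + x\<^sub>i\<close>, \<open>j \<in> S\<close>,
  at \<open>S\<close> with \<open>j\<close> replaced by \<open>i\<close>; the transvection is the identity modulo \<open>x\<^sub>i\<close>.
\<close>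

lemma mvar_dvd_ext_coeff:
  fixes u :: "('a::{field,finite}, 'n::{finite,linorder}) poly_ext"
  assumes u: "u \<in> ext_invariants" and S: "S \<noteq> {}" "i \<notin> S"
  shows "mvar i dvd ext_coeff u S"
proof -
  obtain j where j: "j \<in> S" using S by auto
  have ij: "i \<noteq> j" using j S by auto
  let ?w = "axis j 1 + axis i 1 :: ('a, 'n) vec"
  have "?w $ j \<noteq> 0" using ij by (simp add: axis_def)
  then obtain g where g: "g \<in> GL" "matrix_inv g = row_matrix j ?w" by (rule obtain_row_matrix)
  define \<eta> where "\<eta> = dx_act g"
  have dx_lin: "(\<Sum>l\<in>UNIV. mconst (axis k 1 $ l) *\<^sub>E dx l) = (dx k :: ('a, 'n) poly_ext)" for k
  proof -
    have "(\<Sum>l\<in>UNIV. mconst (axis k 1 $ l) *\<^sub>E dx l) =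
      (\<Sum>l\<in>UNIV. if l = k then dx l else (0 :: ('a, 'n) poly_ext))"
      by (rule sum.cong) (auto simp: axis_def)
    then show ?thesis by simp
  qed
  have \<eta>: "\<eta> k = (if k = j then dx j + dx i else dx k)" for k
    by (simp add: \<eta>_def dx_act_def g(2) row_matrix_def mconst_add ext.scale_left_distrib
        sum.distrib dx_lin)
  have \<eta>_dx: "ordered_prod \<eta> V = ordered_prod dx V" if "j \<notin> V" for V
    unfolding ordered_prod_def
    by (rule arg_cong[where f = prod_list], rule map_cong) (use that in \<open>auto simp: \<eta>\<close>)
  define U where "U = insert i (S - {j})"
  \<comment> \<open>The sign of taking \<open>dx j\<close> out of the monomial of \<open>S\<close>
    and sorting \<open>dx i\<close> in.\<close>
  define s :: "('a, 'n) mpoly"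
    where "s = (- 1) ^ (card {k \<in> S - {j}. k < j} + card {k \<in> U. k < i})"
  have ss: "s * s = 1" by (simp add: s_def flip: power_add)
  \<comment> \<open>If \<open>j\<close> is in \<open>V\<close>, the summand \<open>dx j\<close> of
    the image keeps \<open>j\<close> and misses \<open>U\<close>, while the summand
    \<open>dx i\<close> reaches \<open>U\<close> only for \<open>V = S\<close>. If \<open>j\<close>
    is not in \<open>V\<close>, the monomial is fixed.\<close>
  have coeff: "ext_coeff (ordered_prod \<eta> V) U = (if V = U then 1 else 0) + (if V = S then s else 0)" for V
  proof (cases "j \<in> V")
    case False
    then have "V \<noteq> S" using j by auto
    then show ?thesis using False by (auto simp: \<eta>_dx ordered_prod_dx)
  next
    case True
    have "j \<notin> U" using ij by (auto simp: U_def)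
    have pow: "ext_coeff ((- 1) ^ m * v) W = (- 1) ^ m * ext_coeff v W" for m W and v :: "('a, 'n) poly_ext"
      by (cases "even m") auto
    have "\<eta> j * ordered_prod \<eta> (V - {j}) = (- 1) ^ card {k \<in> V - {j}. k < j} * ordered_prod \<eta> V"
      using ordered_prod_insert[of "dx_act g" j "V - {j}", OF dx_act_sq dx_act_anticomm] True
      by (simp add: \<eta>_def insert_absorb)
    then have "ordered_prod \<eta> V = (- 1) ^ card {k \<in> V - {j}. k < j} * (\<eta> j * ordered_prod \<eta> (V - {j}))"
      by (simp flip: mult.assoc power_add)
    then have "ext_coeff (ordered_prod \<eta> V) U = (- 1) ^ card {k \<in> V - {j}. k < j} *
        ((- 1) ^ card {k \<in> U. k < i} * (if U - {i} = V - {j} then 1 else 0))"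
      using \<open>j \<notin> U\<close> \<eta>_dx[of "V - {j}"]
      by (simp add: pow \<eta> distrib_right ext_coeff_dx_mult ordered_prod_dx U_def)
    moreover have "U - {i} = V - {j} \<longleftrightarrow> V = S" using True j S by (auto simp: U_def)
    moreover have "V \<noteq> U" using True \<open>j \<notin> U\<close> by auto
    ultimately show ?thesis by (auto simp: s_def power_add)
  qed
  have "ext_coeff u U = ext_coeff (ext_act g u) U"
    using u g by (simp add: ext_invariants_def)
  also have "\<dots> = (\<Sum>V\<in>UNIV. (if V = U then poly_act g (ext_coeff u V) else 0) +
      (if V = S then poly_act g (ext_coeff u V) * s else 0))"
    unfolding ext_act_def ext_coeff_sum ext_coeff_simps \<eta>_def[symmetric] coeff
    by (rule sum.cong) (auto simp: distrib_left)
  also have "\<dots> = poly_act g (ext_coeff u U) + poly_act g (ext_coeff u S) * s"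
    by (simp add: sum.distrib)
  finally have eq: "poly_act g (ext_coeff u S) * s = - (poly_act g (ext_coeff u U) - ext_coeff u U)"
    by (simp add: algebra_simps)
  have dvd: "mvar i dvd poly_act g f - f" for f
    unfolding poly_act_eq_subst
  proof (rule dvd_mpoly_subst_diff)
    fix k
    have "lin (v + w) = lin v + lin w" for v w :: "('a, 'n) vec"
      by (simp add: lin_def mconst_add distrib_right sum.distrib)
    then show "mvar i dvd lin (matrix_inv g $ k) - mvar k"
      by (simp add: g(2) row_matrix_def)
  qed
  have "mvar i dvd poly_act g (ext_coeff u S) * s"
    unfolding eq using dvd by (simp only: dvd_minus_iff)
  then have "mvar i dvd poly_act g (ext_coeff u S) * s * s" by (rule dvd_mult2)
  then have "mvar i dvd poly_act g (ext_coeff u S)" by (simp add: mult.assoc ss)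
  from dvd_diff[OF this dvd[of "ext_coeff u S"]] show ?thesis by simp
qed

text \<open>The summand \<open>k = i\<close> carries a power of \<open>x_i\<close>; any other reads
  a coefficient at the nonempty set \<open>insert k S\<close>, which avoids \<open>i\<close>. Hence
  one operation already extends divisibility to the constant term.\<close>

lemma mvar_dvd_ext_coeff_milnor:
  fixes u :: "('a::{field,finite}, 'n::{finite,linorder}) poly_ext"
  assumes "\<And>S. S \<noteq> {} \<Longrightarrow> i \<notin> S \<Longrightarrow> mvar i dvd ext_coeff u S" "i \<notin> S"
  shows "mvar i dvd ext_coeff (milnor j u) S"
  unfolding milnor.rep_eq
proof (rule dvd_sum)
  fix k assume "k \<in> - S"
  show "mvar i dvd (- 1) ^ card {l \<in> S. l < k} * mvar k ^ CARD('a) ^ j * ext_coeff u (insert k S)"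
  proof (cases "k = i")
    case True
    have "mvar i dvd mvar i ^ CARD('a) ^ j" by (rule dvd_power) simp
    then show ?thesis using True by (simp add: dvd_mult dvd_mult2)
  next
    case False
    then show ?thesis using assms by (intro dvd_mult) auto
  qed
qed

lemma mvar_dvd_ext_coeff_milnor_set:
  fixes u :: "('a::{field,finite}, 'n::{finite,linorder}) poly_ext" and J :: "nat set"
  assumes "finite J" "J \<noteq> {}" "\<And>S. S \<noteq> {} \<Longrightarrow> i \<notin> S \<Longrightarrow> mvar i dvd ext_coeff u S" "i \<notin> S"
  shows "mvar i dvd ext_coeff (milnor_set J u) S"
  using assms(1,2,4)
proof (induction J arbitrary: S rule: finite_linorder_min_induct)
  case (insert k J)
  have "mvar i dvd ext_coeff (milnor k (milnor_set J u)) S"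
  proof (rule mvar_dvd_ext_coeff_milnor)
    fix T assume "T \<noteq> {}" "i \<notin> T"
    then show "mvar i dvd ext_coeff (milnor_set J u) T"
      using insert.IH assms(3) by (cases "J = {}") auto
  qed (use insert.prems in auto)
  then show ?case using insert.hyps by (simp add: milnor_set_insert_min)
qed simp

lemma mvar_dvd_moore: "mvar i dvd (moore :: ('a::{field,finite}, 'n::{finite,linorder}) mpoly)"
  unfolding moore_def e_elt_def
proof (rule mvar_dvd_ext_coeff_milnor_set)
  show "mvar i dvd ext_coeff dx_top S" if "i \<notin> S" for S
    using that by (auto simp: dx_top_def ordered_prod_dx)
qed (auto simp: lessThan_empty_iff)

text \<open>All nonzero field elements are roots of \<open>X^m - 1\<close>, a polynomial of degree
  \<open>m\<close>.\<close>

lemma card_minus_1_le_exponent: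
  assumes "m > 0" "\<And>a :: 'a::{field,finite}. a \<noteq> 0 \<Longrightarrow> a ^ m = 1"
  shows "CARD('a) - 1 \<le> m"
proof -
  let ?p = "- 1 + monom 1 m :: 'a poly"
  have deg: "degree ?p = m"
    using assms(1) by (subst degree_add_eq_right) (auto simp: degree_monom_eq)
  then have "?p \<noteq> 0" using assms(1) by auto
  then have "card {x. poly ?p x = 0} \<le> m" using card_poly_roots_bound[of ?p] deg by simp
  moreover have "UNIV - {0} \<subseteq> {x. poly ?p x = 0}" using assms(2) by (auto simp: poly_monom)
  then have "card (UNIV - {0 :: 'a}) \<le> card {x. poly ?p x = 0}" by (intro card_mono) auto
  ultimately show ?thesis by simp
qed

text \<open>Scaling \<open>x_i\<close> by \<open>a\<close> multiplies the coefficient of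
  \<open>m\<close> by \<open>a ^ lookup m i\<close>, so this power is 1 for every nonzero
  \<open>a\<close>. Divisibility by \<open>x_i\<close> excludes the exponent 0, and the root count
  gives the bound.\<close>

lemma mvar_power_dvd_invariant:
  fixes f :: "('a::{field,finite}, 'n::{finite,linorder}) mpoly"
  assumes "f \<in> poly_invariants" "mvar i dvd f"
  shows "mvar i ^ (CARD('a) - 1) dvd f"
  unfolding mvar_power_dvd_iff
proof
  fix m assume m: "m \<in> keys f"
  have "a ^ lookup m i = 1" if "a \<noteq> 0" for a :: 'a
  proof -
    have "axis i a $ i \<noteq> 0" using that by (simp add: axis_def)
    then obtain g where g: "g \<in> GL" "matrix_inv g = row_matrix i (axis i a)" by (rule obtain_row_matrix)
    have single: "poly_act g (Poly_Mapping.single k c) =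
      Poly_Mapping.single k (a ^ lookup k i * c)" for k c
    proof -
      have "axis i a = a *s axis i 1" by (auto simp: vec_eq_iff axis_def)
      then have "lin (matrix_inv g $ l) = (if l = i then mconst a else 1) * mvar l" for l
        by (simp add: g(2) row_matrix_def lin_scale)
      then have "poly_act g (Poly_Mapping.single k c) =
        mconst c * (\<Prod>l\<in>UNIV. (if l = i then mconst a else 1) ^ lookup k l * mvar l ^ lookup k l)"
        by (simp only: poly_act_eq_subst mpoly_subst_single power_mult_distrib)
      also have "\<dots> = (\<Prod>l\<in>UNIV. (if l = i then mconst a else 1) ^ lookup k l) *
          (mconst c * (\<Prod>l\<in>UNIV. mvar l ^ lookup k l))"
        by (simp only: prod.distrib mult.left_commute)
      also have "(\<Prod>l\<in>UNIV. (if l = i then mconst a else 1) ^ lookup k l) =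
          (\<Prod>l\<in>UNIV. if l = i then mconst (a ^ lookup k i) else (1 :: ('a, 'n) mpoly))"
        by (rule prod.cong) (auto simp: mconst_power)
      also have "\<dots> = mconst (a ^ lookup k i)" by simp
      also have "mconst c * (\<Prod>l\<in>UNIV. mvar l ^ lookup k l) = Poly_Mapping.single k c"
        using mpoly_subst_single[of mvar k c] by (simp add: mpoly_subst_mvar_id)
      finally show ?thesis by (simp add: mconst_def mult_single)
    qed
    have "lookup f m = lookup (poly_act g f) m" using assms(1) g(1) by (simp add: poly_invariants_def)
    also have "poly_act g f = (\<Sum>k\<in>keys f. poly_act g (Poly_Mapping.single k (lookup f k)))"
      by (subst mpoly_expand[of f]) (simp only: poly_act_def mpoly_subst_sum)
    also have "lookup \<dots> m = (\<Sum>k\<in>keys f. if k = m then a ^ lookup m i * lookup f m else 0)"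
      unfolding lookup_sum single by (rule sum.cong) (auto simp: lookup_single when_def)
    also have "\<dots> = a ^ lookup m i * lookup f m" using m by simp
    finally show ?thesis using m by (simp add: in_keys_iff)
  qed
  moreover have "lookup m i > 0"
    using assms(2) mvar_power_dvd_iff[of i 1 f] m by force
  ultimately show "CARD('a) - 1 \<le> lookup m i" by (intro card_minus_1_le_exponent)
qed

section \<open>Linear forms up to scalars\<close>

lemma obtain_poly_act_lin:
  fixes v :: "('a::{field,finite}, 'n::{finite,linorder}) vec"
  assumes "v \<noteq> 0"
  obtains g j where "g \<in> GL" "poly_act g (mvar j) = lin v"
proof -
  obtain j where "v $ j \<noteq> 0" using assms by (auto simp: vec_eq_iff)
  then obtain g where "g \<in> GL" "matrix_inv g = row_matrix j v" by (rule obtain_row_matrix)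
  then show thesis
    by (intro that[of g j]) (auto simp: poly_act_eq_subst row_matrix_def)
qed

text \<open>A ring automorphism carries the prime \<open>mvar j\<close> to
  \<open>lin v\<close>.\<close>

lemma prime_elem_lin:
  fixes v :: "('a::{field,finite}, 'n::{finite,linorder}) vec"
  assumes "v \<noteq> 0"
  shows "prime_elem (lin v)"
proof -
  from assms obtain g j where g: "g \<in> GL" and j: "poly_act g (mvar j) = lin v" by (rule obtain_poly_act_lin)
  define \<psi> where "\<psi> = poly_act (matrix_inv g)"
  have dvd: "lin v dvd f \<longleftrightarrow> mvar j dvd \<psi> f" for f
  proof
    assume "lin v dvd f"
    then have "\<psi> (lin v) dvd \<psi> f" by (auto simp: \<psi>_def poly_act_mult)
    then show "mvar j dvd \<psi> f" unfolding \<psi>_def j[symmetric] poly_act_inverse[OF g] .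
  next
    assume "mvar j dvd \<psi> f"
    then have "poly_act g (mvar j) dvd poly_act g (\<psi> f)" by (auto simp: poly_act_mult)
    then show "lin v dvd f" unfolding \<psi>_def j poly_act_inverse[OF g] .
  qed
  have "lin v \<noteq> 0"
  proof
    assume "lin v = 0"
    then have "\<psi> (poly_act g (mvar j)) = 0" by (simp add: j \<psi>_def)
    then show False unfolding \<psi>_def poly_act_inverse[OF g] by simp
  qed
  moreover have "\<not> mvar j dvd (1 :: ('a, 'n) mpoly)"
    using prime_elem_mvar[of j, where 'a = 'a] by (simp add: prime_elem_def)
  ultimately show ?thesis
    unfolding prime_elem_def dvd
    using prime_elem_dvd_multD'[OF prime_elem_mvar[of j, where 'a = 'a]]
    by (simp add: \<psi>_def poly_act_mult)
qed

text \<open>Representatives of the points of projective space, one for each line.\<close>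

definition monic_vecs :: "('a::field, 'n::{finite,linorder}) vec set" where
  "monic_vecs = {v. \<exists>j. v $ j = 1 \<and> (\<forall>k<j. v $ k = 0)}"

lemma monic_vecs_ne_0: "v \<in> monic_vecs \<Longrightarrow> v \<noteq> 0"
  by (auto simp: monic_vecs_def)

lemma monic_vecs_scale_eq:
  assumes "v \<in> monic_vecs" "w \<in> monic_vecs" "c \<noteq> 0" "w = c *s v"
  shows "v = w"
proof -
  obtain i j where ij: "v $ i = 1" "\<forall>k<i. v $ k = 0" "w $ j = 1" "\<forall>k<j. w $ k = 0"
    using assms by (auto simp: monic_vecs_def)
  have "i = j"
  proof (rule linorder_cases[of i j])
    assume "i < j"
    then have "w $ i = 0" using ij by simp
    then show ?thesis using ij assms(3,4) by simp
  next
    assume "j < i"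
    then have "w $ j = 0" using ij assms(4) by simp
    then show ?thesis using ij by simp
  qed
  then have "c = 1" using ij assms(4) by simp
  then show ?thesis using assms(4) by simp
qed

text \<open>Every nonzero vector is a nonzero multiple of a monic one. This lower bound is the
  direction used in the degree comparison with \<open>moore\<close>.\<close>

lemma card_monic_vecs:
  "CARD('a) ^ CARD('n) - 1 \<le> card (monic_vecs :: ('a::{field,finite}, 'n::{finite,linorder}) vec set) * (CARD('a) - 1)"
proof -
  let ?R = "monic_vecs :: ('a, 'n) vec set"
  have "v \<in> (\<lambda>(w, c). c *s w) ` (?R \<times> (UNIV - {0}))" if "v \<noteq> 0" for v :: "('a, 'n) vec"
  proof -
    let ?A = "{k. v $ k \<noteq> 0}"
    have "?A \<noteq> {}" using that by (auto simp: vec_eq_iff)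
    then have "v $ Min ?A \<noteq> 0" using Min_in[of ?A] by simp
    moreover have "v $ k = 0" if "k < Min ?A" for k
      using that Min_le[of ?A k] by (auto simp: not_le[symmetric])
    ultimately obtain j where j: "v $ j \<noteq> 0" "\<forall>k<j. v $ k = 0" by blast
    let ?w = "(1 / v $ j) *s v"
    have "?w $ j = 1 \<and> (\<forall>k<j. ?w $ k = 0)" using j by simp
    then have "?w \<in> ?R" unfolding monic_vecs_def by blast
    then have "(?w, v $ j) \<in> ?R \<times> (UNIV - {0})" using j by simp
    moreover have "v = (\<lambda>(w, c). c *s w) (?w, v $ j)" using j by (simp add: vec_eq_iff)
    ultimately show ?thesis by (rule rev_image_eqI)
  qed
  then have "card (UNIV - {0 :: ('a, 'n) vec}) \<le> card (?R \<times> (UNIV - {0 :: 'a}))"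
    by (intro surj_card_le[where f = "\<lambda>(w, c). c *s w"]) auto
  then show ?thesis by (simp add: card_cartesian_product)
qed

text \<open>Moving \<open>mvar j\<close> to \<open>lin v\<close> by a group element fixes
  \<open>f\<close>, so the power of \<open>mvar j\<close> dividing \<open>f\<close> becomes one of
  \<open>lin v\<close>. Distinct monic vectors give nonassociated primes.\<close>

lemma prod_lin_dvd_invariant:
  fixes f :: "('a::{field,finite}, 'n::{finite,linorder}) mpoly"
  assumes "f \<in> poly_invariants" "\<And>i. mvar i dvd f"
  shows "(\<Prod>v\<in>monic_vecs. lin v ^ (CARD('a) - 1)) dvd f"
proof (rule prod_prime_power_dvd)
  fix v :: "('a, 'n) vec" assume "v \<in> monic_vecs"
  then have v: "v \<noteq> 0" by (rule monic_vecs_ne_0)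
  then show "prime_elem (lin v)" by (rule prime_elem_lin)
  from v obtain g j where g: "g \<in> GL" and j: "poly_act g (mvar j) = lin v" by (rule obtain_poly_act_lin)
  have "mvar j ^ (CARD('a) - 1) dvd f" using assms by (intro mvar_power_dvd_invariant)
  then have "poly_act g (mvar j ^ (CARD('a) - 1)) dvd poly_act g f" by (auto simp: poly_act_mult)
  then show "lin v ^ (CARD('a) - 1) dvd f" using assms(1) g j by (simp add: poly_invariants_def)
next
  fix v w :: "('a, 'n) vec"
  assume *: "v \<in> monic_vecs" "w \<in> monic_vecs" "lin v dvd lin w"
  obtain c where "c \<noteq> 0" "w = c *s v"
    by (rule lin_dvd_lin_imp[OF *(3) monic_vecs_ne_0[OF *(2)]])
  then show "v = w" by (rule monic_vecs_scale_eq[OF *(1,2)])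
qed simp

lemma moore_power_invariant:
  assumes "prime p" "CARD('a) = p ^ k"
  shows "(moore :: ('a::{field,finite}, 'n::{finite,linorder}) mpoly) ^ (CARD('a) - 1) \<in> poly_invariants"
proof -
  have "poly_act g (moore ^ (CARD('a) - 1)) = moore ^ (CARD('a) - 1)"
    if g: "g \<in> GL" for g :: "('a, 'n) sq_matrix"
  proof -
    obtain c where "c \<noteq> 0" "poly_act g (moore :: ('a, 'n) mpoly) = mconst c * moore"
      using ext_act_milnor_set_dx_top[OF assms g] by blast
    then show ?thesis
      using finite_field_power_card_minus_1[of c] by (simp add: power_mult_distrib flip: mconst_power)
  qed
  then show ?thesis by (simp add: poly_invariants_def)
qed

text \<open>
  Both \<open>f\<close> and \<open>moore ^ (q - 1)\<close> are divisible by the product of the \<open>(q - 1)\<close>-th powers of all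
  linear forms up to scalars, whose degree is that of \<open>moore ^ (q - 1)\<close>.
\<close>

lemma moore_power_dvd_invariant:
  fixes f :: "('a::{field,finite}, 'n::{finite,linorder}) mpoly"
  assumes "prime p" "CARD('a) = p ^ k" "f \<in> poly_invariants" "\<And>i. mvar i dvd f"
  shows "moore ^ (CARD('a) - 1) dvd f"
proof -
  let ?q = "CARD('a)" and ?n = "CARD('n)"
  let ?P = "\<Prod>v\<in>monic_vecs. lin v ^ (?q - 1) :: ('a, 'n) mpoly"
  let ?L = "moore ^ (?q - 1) :: ('a, 'n) mpoly"
  have q: "?q - 1 > 0" using card_field_gt_1[where 'a = 'a] by simp
  have "?P dvd ?L"
  proof (rule prod_lin_dvd_invariant[OF moore_power_invariant[OF assms(1,2)]])
    fix i :: 'n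
    have "(moore :: ('a, 'n) mpoly) dvd ?L" using q by (intro dvd_power) simp
    with mvar_dvd_moore[of i] show "mvar i dvd ?L" by (rule dvd_trans)
  qed
  then obtain h where "?L = ?P * h" by (rule dvdE)
  then have h: "?L = h * ?P" by (simp only: mult.commute)
  \<comment> \<open>Geometric series: \<open>moore ^ (q - 1)\<close> has degree
    \<open>q^n - 1\<close>, the number of nonzero vectors.\<close>
  have "(?q - 1) * (\<Sum>j<m. ?q ^ j) + 1 = ?q ^ m" for m
  proof (induction m)
    case (Suc m)
    have "(?q - 1) * (\<Sum>j<Suc m. ?q ^ j) + 1 = ((?q - 1) * (\<Sum>j<m. ?q ^ j) + 1) + (?q - 1) * ?q ^ m"
      by (simp add: distrib_left)
    also have "\<dots> = (1 + (?q - 1)) * ?q ^ m" unfolding Suc by (simp only: distrib_right mult_1)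
    also have "1 + (?q - 1) = ?q" using q by linarith
    finally show ?case by simp
  qed simp
  from this[of ?n] have deg: "(?q - 1) * (\<Sum>j<?n. ?q ^ j) = ?q ^ ?n - 1" by simp
  have hP: "homogeneous (card (monic_vecs :: ('a, 'n) vec set) * ((?q - 1) * 1)) ?P"
    by (intro homogeneous_prod homogeneous_power homogeneous_lin)
  have hL: "homogeneous ((?q - 1) * (\<Sum>j<?n. ?q ^ j)) ?L"
    by (intro homogeneous_power homogeneous_moore)
  have le: "(?q - 1) * (\<Sum>j<?n. ?q ^ j) \<le> card (monic_vecs :: ('a, 'n) vec set) * ((?q - 1) * 1)"
    unfolding deg using card_monic_vecs[where 'a = 'a and 'n = 'n] by simp
  have "?L \<noteq> 0" by (simp add: moore_ne_0)
  then obtain c where c: "h = mconst c" "c \<noteq> 0"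
    by (rule homogeneous_dvd_const[OF hP hL le h])
  have "mconst (1 / c) * ?L = mconst (1 / c * c) * ?P" unfolding h c(1) mconst_mult by (simp add: mult.assoc)
  then have "?P = mconst (1 / c) * ?L" using c by simp
  then have "?L dvd ?P" by simp
  also have "?P dvd f" using assms(3,4) by (rule prod_lin_dvd_invariant)
  finally show ?thesis .
qed

section \<open>The basis\<close>

text \<open>Passes from a family over \<open>J\<close> to the set of its values. Independence is
  over the whole scalar ring, while spanning has to produce coefficients in
  \<open>R\<close>.\<close>

lemma free_module_with_basisI:
  fixes sm :: "'r::comm_ring_1 \<Rightarrow> 'm::ab_group_add \<Rightarrow> 'm" and \<beta> :: "'i \<Rightarrow> 'm"
  assumes "module sm" and "finite J" and "\<beta> ` J \<subseteq> M"
    and ring: "1 \<in> R" "\<And>a b. a \<in> R \<Longrightarrow> b \<in> R \<Longrightarrow> a - b \<in> R" "\<And>a b. a \<in> R \<Longrightarrow> b \<in> R \<Longrightarrow> a * b \<in> R"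
    and M: "0 \<in> M" "\<And>u v. u \<in> M \<Longrightarrow> v \<in> M \<Longrightarrow> u + v \<in> M" "\<And>a u. a \<in> R \<Longrightarrow> u \<in> M \<Longrightarrow> sm a u \<in> M"
    and indep: "\<And>c i. (\<Sum>i\<in>J. sm (c i) (\<beta> i)) = 0 \<Longrightarrow> i \<in> J \<Longrightarrow> c i = 0"
    and span: "\<And>u. u \<in> M \<Longrightarrow> \<exists>c. c ` J \<subseteq> R \<and> u = (\<Sum>i\<in>J. sm (c i) (\<beta> i))"
  shows "inj_on \<beta> J \<and> free_module_with_basis sm R M (\<beta> ` J)"
proof -
  interpret module sm by fact
  have inj: "inj_on \<beta> J"
  proof (rule inj_onI, rule ccontr)
    fix i j assume *: "i \<in> J" "j \<in> J" "\<beta> i = \<beta> j" "i \<noteq> j"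
    \<comment> \<open>Equal values at distinct indices would give the nontrivial relation
      \<open>\<beta> i - \<beta> j = 0\<close>.\<close>
    have "(\<Sum>k\<in>J. sm ((if k = i then 1 else 0) - (if k = j then 1 else 0)) (\<beta> k)) =
      (\<Sum>k\<in>J. if k = i then \<beta> i else 0) - (\<Sum>k\<in>J. if k = j then \<beta> j else 0)"
      unfolding sum_subtractf[symmetric] by (rule sum.cong) (auto simp: scale_left_diff_distrib)
    also have "\<dots> = 0" using * assms(2) by simp
    finally show False using indep[of "\<lambda>k. (if k = i then 1 else 0) - (if k = j then 1 else 0)" i] * by auto
  qed
  have sum_eq: "(\<Sum>b | c b \<noteq> 0. sm (c b) b) = (\<Sum>i\<in>J. sm (c (\<beta> i)) (\<beta> i))"
    if "{b. c b \<noteq> 0} \<subseteq> \<beta> ` J" for c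
  proof -
    have "(\<Sum>b | c b \<noteq> 0. sm (c b) b) = (\<Sum>b\<in>\<beta> ` J. sm (c b) b)"
      by (rule sum.mono_neutral_left) (use that assms(2) in auto)
    then show ?thesis by (simp add: sum.reindex[OF inj])
  qed
  have unique: "\<exists>!c. finite {b. c b \<noteq> 0} \<and> {b. c b \<noteq> 0} \<subseteq> \<beta> ` J \<and> c ` \<beta> ` J \<subseteq> R \<and>
      u = (\<Sum>b | c b \<noteq> 0. sm (c b) b)" if u: "u \<in> M" for u
  proof (rule ex_ex1I)
    obtain c where c: "c ` J \<subseteq> R" "u = (\<Sum>i\<in>J. sm (c i) (\<beta> i))" using span[OF u] by blast
    define d where "d b = (if b \<in> \<beta> ` J then c (inv_into J \<beta> b) else 0)" for b
    have d: "d (\<beta> i) = c i" if "i \<in> J" for i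
      using that inj by (simp add: d_def)
    have sub: "{b. d b \<noteq> 0} \<subseteq> \<beta> ` J" by (auto simp: d_def)
    moreover have "finite {b. d b \<noteq> 0}" using sub assms(2) finite_surj by blast
    moreover have "d ` \<beta> ` J \<subseteq> R" using c(1) d by auto
    moreover have "u = (\<Sum>b | d b \<noteq> 0. sm (d b) b)"
      unfolding sum_eq[OF sub] c(2) by (rule sum.cong) (auto simp: d)
    ultimately show "\<exists>c. finite {b. c b \<noteq> 0} \<and> {b. c b \<noteq> 0} \<subseteq> \<beta> ` J \<and> c ` \<beta> ` J \<subseteq> R \<and>
        u = (\<Sum>b | c b \<noteq> 0. sm (c b) b)" by blast
  next
    fix c d
    assume c: "finite {b. c b \<noteq> 0} \<and> {b. c b \<noteq> 0} \<subseteq> \<beta> ` J \<and> c ` \<beta> ` J \<subseteq> R \<and>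
        u = (\<Sum>b | c b \<noteq> 0. sm (c b) b)"
      and d: "finite {b. d b \<noteq> 0} \<and> {b. d b \<noteq> 0} \<subseteq> \<beta> ` J \<and> d ` \<beta> ` J \<subseteq> R \<and>
        u = (\<Sum>b | d b \<noteq> 0. sm (d b) b)"
    have "(\<Sum>b | c b \<noteq> 0. sm (c b) b) = (\<Sum>b | d b \<noteq> 0. sm (d b) b)" using c d by simp
    then have "(\<Sum>i\<in>J. sm (c (\<beta> i)) (\<beta> i)) = (\<Sum>i\<in>J. sm (d (\<beta> i)) (\<beta> i))"
      using c d by (simp only: sum_eq)
    then have "(\<Sum>i\<in>J. sm (c (\<beta> i) - d (\<beta> i)) (\<beta> i)) = 0"
      by (simp add: scale_left_diff_distrib sum_subtractf)
    then have eq: "c (\<beta> i) = d (\<beta> i)" if "i \<in> J" for i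
      using indep[of "\<lambda>i. c (\<beta> i) - d (\<beta> i)" i] that by simp
    have sub: "{b. c b \<noteq> 0} \<subseteq> \<beta> ` J" "{b. d b \<noteq> 0} \<subseteq> \<beta> ` J" using c d by simp_all
    show "c = d"
    proof (rule ext)
      fix b
      show "c b = d b"
      proof (cases "b \<in> \<beta> ` J")
        case False
        then have "c b = 0" "d b = 0" using sub by auto
        then show ?thesis by simp
      qed (use eq in auto)
    qed
  qed
  show ?thesis
    unfolding free_module_with_basis_def
    by (intro conjI ballI) (rule inj assms(1,3) ring M unique, assumption?, assumption?)+
qed

lemma ext_scale_one_power: "(f *\<^sub>E 1) ^ m = f ^ m *\<^sub>E 1"
  by (induction m) (simp_all add: ext_scale_mult_left)

lemma ext_scale_left_cancel:
  fixes f :: "'r::idom"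
  assumes "f *\<^sub>E u = f *\<^sub>E v" "f \<noteq> 0"
  shows "u = v"
proof (rule exterior_eqI)
  fix S
  have "ext_coeff (f *\<^sub>E u) S = ext_coeff (f *\<^sub>E v) S" by (simp only: assms(1))
  then show "ext_coeff u S = ext_coeff v S" using assms(2) by simp
qed

theorem theorem1p2:
  fixes p q k :: nat
    and b :: "nat set \<Rightarrow> ('a::{field,finite}, 'n::{finite,linorder}) poly_ext"
  assumes "prime p" and "odd p" and "q = p ^ k" and "CARD('a) = q"
    and b: "\<And>I. b I = e_elt ^ (q - 2) * milnor_set I dx_top"
  shows "inj_on b {I. I \<subset> {..<CARD('n)}} \<and>
    1 \<notin> b ` {I. I \<subset> {..<CARD('n)}} \<and>
    free_module_with_basis (*\<^sub>E) poly_invariants ext_invariants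
      ({1} \<union> b ` {I. I \<subset> {..<CARD('n)}})"
proof -
  let ?N = "{..<CARD('n)}"
  \<comment> \<open>The basis element 1 receives the otherwise missing index \<open>?N\<close>, so
    that \<open>moore_\<beta>\<close> relates basis and \<open>milnor_set I dx_top\<close> uniformly
    over \<open>Pow ?N\<close>.\<close>
  define \<beta> where "\<beta> I = (if I = ?N then 1 else b I)" for I
  have card: "CARD('a) = p ^ k" using assms by simp
  note pk = assms(1) card
  have "q > 1" using card_field_gt_1[where 'a = 'a] assms(4) by simp
  then have q: "q - 1 = Suc (q - 2)" by simp
  have b_eq: "b I = moore ^ (q - 2) *\<^sub>E milnor_set I dx_top" for I
    by (simp add: b e_elt_eq_moore ext_scale_one_power ext_scale_mult_left)
  define m :: "nat set \<Rightarrow> ('a, 'n) mpoly" where "m I = (if I = ?N then 1 else moore ^ (q - 1))" for I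
  have e: "milnor_set ?N (dx_top :: ('a, 'n) poly_ext) = moore *\<^sub>E 1"
    using e_elt_eq_moore by (simp only: e_elt_def)
  have moore_\<beta>: "moore *\<^sub>E \<beta> I = m I *\<^sub>E milnor_set I dx_top" for I
  proof (cases "I = ?N")
    case False
    then have "m I = moore * moore ^ (q - 2)" unfolding m_def q by simp
    with False show ?thesis by (simp add: \<beta>_def b_eq)
  qed (simp add: \<beta>_def m_def e)
  have m_ne_0: "m I \<noteq> 0" for I by (simp add: m_def moore_ne_0)
  have m_inv: "poly_act g (m I) = m I" if "g \<in> GL" for g I
    using moore_power_invariant[OF pk, where 'n = 'n] that assms(4)
    by (auto simp: m_def poly_invariants_def)
  have b_inv: "ext_act g (b I) = b I" if g: "g \<in> GL" for g I
  proof -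
    obtain c where "c \<noteq> 0" "poly_act g (moore :: ('a, 'n) mpoly) = mconst c * moore"
      "ext_act g (milnor_set I dx_top) = mconst c *\<^sub>E milnor_set I (dx_top :: ('a, 'n) poly_ext)"
      using ext_act_milnor_set_dx_top[OF pk g] by blast
    \<comment> \<open>The exponent \<open>q - 2\<close> is chosen for this: with the factor from
      \<open>milnor_set I dx_top\<close> the character occurs to the power \<open>q - 1\<close> and
      becomes trivial.\<close>
    moreover have "(mconst c * moore) ^ (q - 2) * mconst c = (moore :: ('a, 'n) mpoly) ^ (q - 2)"
    proof -
      have "(mconst c * moore) ^ (q - 2) * mconst c = mconst (c ^ (q - 1)) * (moore :: ('a, 'n) mpoly) ^ (q - 2)"
        unfolding q by (simp add: power_mult_distrib mconst_power mconst_mult mult_ac)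
      then show ?thesis using finite_field_power_card_minus_1[of c] \<open>c \<noteq> 0\<close> assms(4) by simp
    qed
    ultimately show ?thesis by (simp add: b_eq ext_act_scale)
  qed
  have in_R: "poly_invariants = {f :: ('a, 'n) mpoly. \<forall>g\<in>GL. poly_act g f = f}"
    by (rule poly_invariants_def)
  have "inj_on \<beta> (Pow ?N) \<and>
    free_module_with_basis (*\<^sub>E) poly_invariants ext_invariants (\<beta> ` Pow ?N)"
  proof (rule free_module_with_basisI)
    show "\<beta> ` Pow ?N \<subseteq> ext_invariants"
      using b_inv by (auto simp: \<beta>_def ext_invariants_def)
  next
    fix c I
    assume "(\<Sum>I\<in>Pow ?N. c I *\<^sub>E \<beta> I) = 0" and I: "I \<in> Pow ?N"
    then have "0 = moore *\<^sub>E (\<Sum>I\<in>Pow ?N. c I *\<^sub>E \<beta> I)" by simp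
    also have "\<dots> = (\<Sum>I\<in>Pow ?N. c I *\<^sub>E moore *\<^sub>E \<beta> I)"
      by (simp add: ext.scale_sum_right mult.commute)
    also have "\<dots> = (\<Sum>I\<in>Pow ?N. (c I * m I) *\<^sub>E milnor_set I dx_top)"
      by (simp add: moore_\<beta>)
    finally have "c I * m I = 0"
      using I milnor_set_dx_top_independent[of "\<lambda>I. c I * m I" I] by simp
    then show "c I = 0" using m_ne_0 by simp
  next
    fix u :: "('a, 'n) poly_ext" assume u: "u \<in> ext_invariants"
    obtain s where s: "\<forall>I\<subseteq>?N. s I \<in> {1, - 1}"
      and exp: "\<forall>u :: ('a, 'n) poly_ext. moore *\<^sub>E u = (\<Sum>I\<in>Pow ?N.
        (s I * ext_coeff (milnor_set (?N - I) u) {}) *\<^sub>E milnor_set I dx_top)"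
      using milnor_set_dx_top_expansion by blast
    have "\<exists>h\<in>poly_invariants. s I * ext_coeff (milnor_set (?N - I) u) {} = h * m I"
      if I: "I \<in> Pow ?N" for I
    proof -
      let ?f = "ext_coeff (milnor_set (?N - I) u) {}"
      have f: "?f \<in> poly_invariants" by (rule poly_invariants_coeff_milnor_set[OF pk u])
      have "m I dvd ?f"
      proof (cases "I = ?N")
        case False
        \<comment> \<open>For proper \<open>I\<close> the complement is nonempty, so at least one
          Milnor operation is applied and the constant term is covered.\<close>
        have "mvar i dvd ?f" for i
          using I False mvar_dvd_ext_coeff[OF u]
          by (intro mvar_dvd_ext_coeff_milnor_set) auto
        then show ?thesis
          using moore_power_dvd_invariant[OF pk f] False assms(4) by (simp add: m_def)
      qed (simp add: m_def)
      then have "m I dvd s I * ?f" by (rule dvd_mult)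
      then obtain h where h: "s I * ?f = h * m I" by (metis dvdE mult.commute)
      \<comment> \<open>The quotient of two invariants is invariant because the divisor
        \<open>m I\<close> can be cancelled in a domain.\<close>
      have "poly_act g h = h" if g: "g \<in> GL" for g
      proof -
        have "poly_act g h * m I = poly_act g (h * m I)"
          by (simp add: poly_act_mult m_inv[OF g])
        also have "\<dots> = poly_act g (s I) * poly_act g ?f"
          by (simp only: poly_act_mult flip: h)
        also have "poly_act g (s I) = s I" using s I by auto
        also have "poly_act g ?f = ?f" using f g by (simp add: in_R)
        finally have "poly_act g h * m I = h * m I" by (simp only: h)
        then show ?thesis using m_ne_0 by simp
      qed
      then show ?thesis using h by (auto simp: in_R)
    qed
    then obtain c where c: "\<And>I. I \<in> Pow ?N \<Longrightarrow> c I \<in> poly_invariants"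
      "\<And>I. I \<in> Pow ?N \<Longrightarrow> s I * ext_coeff (milnor_set (?N - I) u) {} = c I * m I"
      by metis
    have "moore *\<^sub>E u = (\<Sum>I\<in>Pow ?N. (c I * m I) *\<^sub>E milnor_set I dx_top)"
      unfolding exp[rule_format, of u] by (rule sum.cong) (simp_all only: c(2))
    also have "\<dots> = (\<Sum>I\<in>Pow ?N. c I *\<^sub>E moore *\<^sub>E \<beta> I)" by (simp add: moore_\<beta>)
    also have "\<dots> = moore *\<^sub>E (\<Sum>I\<in>Pow ?N. c I *\<^sub>E \<beta> I)"
      by (simp add: ext.scale_sum_right mult.commute)
    finally have "u = (\<Sum>I\<in>Pow ?N. c I *\<^sub>E \<beta> I)"
      by (rule ext_scale_left_cancel) (rule moore_ne_0)
    then show "\<exists>c. c ` Pow ?N \<subseteq> poly_invariants \<and> u = (\<Sum>I\<in>Pow ?N. c I *\<^sub>E \<beta> I)"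
      using c(1) by blast
  qed (auto simp: module_ext_scale in_R ext_invariants_def poly_act_mult ext_act_add ext_act_scale)
  then have inj: "inj_on \<beta> (Pow ?N)"
    and basis: "free_module_with_basis (*\<^sub>E) poly_invariants ext_invariants (\<beta> ` Pow ?N)"
    by simp_all
  have "\<beta> ` Pow ?N = {1} \<union> b ` {I. I \<subset> ?N}"
    by (auto simp: \<beta>_def image_iff)
  moreover have \<beta>_b: "\<beta> I = b I" if "I \<subset> ?N" for I using that by (auto simp: \<beta>_def)
  moreover have "inj_on b {I. I \<subset> ?N}"
  proof (rule inj_onI)
    fix I J assume "I \<in> {I. I \<subset> ?N}" "J \<in> {I. I \<subset> ?N}" "b I = b J"
    then have "\<beta> I = \<beta> J" "I \<in> Pow ?N" "J \<in> Pow ?N" using \<beta>_b by auto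
    then show "I = J" by (rule inj_onD[OF inj])
  qed
  moreover have "1 \<notin> b ` {I. I \<subset> ?N}"
  proof
    assume "1 \<in> b ` {I. I \<subset> ?N}"
    then obtain I where I: "I \<in> {I. I \<subset> ?N}" "1 = b I" by (rule imageE)
    \<comment> \<open>An equality \<open>1 = b I\<close> would make \<open>\<beta>\<close> take the
      same value at \<open>I\<close> and at the full index set.\<close>
    have "\<beta> I = \<beta> ?N" using I \<beta>_b[of I] by (simp add: \<beta>_def)
    moreover have "I \<in> Pow ?N" "?N \<in> Pow ?N" using I by auto
    ultimately have "I = ?N" by (rule inj_onD[OF inj])
    with I show False by simp
  qed
  ultimately show ?thesis using basis by simp
qed

end
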